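(* In every acceptable universal left-r.e. numbering $\alpha$, the index set $\{e:\alpha_e\text{ is Kurtz random}\}$ is $\Pi_3$-hard.
   Context: Reals are infinite binary sequences, identified with numbers in $[0,1]$. A real is left-r.e. if it is the limit of a recursive nondecreasing sequence of rationals. A left-r.e. numbering is a map $e\mapsto\alpha_e=\sum_{x\in\operatorname{dom}\varphi_e}2^{-|x|}$ (with $|x|=\lceil\log(x+1)\rceil$) for some partial recursive $\langle e,x\rangle\mapsto\varphi_e(x)$; it is universal if every left-r.e. real occurs, and acceptable if for every left-r.e. numbering $\beta$ there is a recursive $f$ with $\alpha_{f(e)}=\beta_e$ for all $e$. A set is $\Pi_3$-hard if every $\Pi^0_3$ set many-one reduces to it. $X$ is Kurtz random if it belongs to no $\Pi^0_1$ class of Lebesgue measure zero. *)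

theory Defs
  imports "HOL-Probability.Probability" "HOL-Library.Nat_Bijection"
begin

text \<open>Partial recursive functions are presented as unary functions on the natural numbers, closed
  under composition, primitive recursion and unbounded minimisation; several arguments are passed
  through the Cantor pairing function \<^const>\<open>prod_encode\<close>.\<close>

inductive partrec :: "(nat \<Rightarrow> nat option) \<Rightarrow> bool" where
  zero: "partrec (\<lambda>_. Some 0)"
| succ: "partrec (\<lambda>n. Some (Suc n))"
| proj1: "partrec (\<lambda>n. Some (fst (prod_decode n)))"
| proj2: "partrec (\<lambda>n. Some (snd (prod_decode n)))"
| pair: "partrec f \<Longrightarrow> partrec g \<Longrightarrow>
    partrec (\<lambda>n. Option.bind (f n) (\<lambda>a. Option.bind (g n) (\<lambda>b. Some (prod_encode (a, b)))))"
| comp: "partrec f \<Longrightarrow> partrec g \<Longrightarrow> partrec (\<lambda>n. Option.bind (g n) f)"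
| prec: "partrec f \<Longrightarrow> partrec g \<Longrightarrow>
    partrec (\<lambda>n. case prod_decode n of (a, k) \<Rightarrow>
      rec_nat (f a)
        (\<lambda>y r. Option.bind r (\<lambda>i. g (prod_encode (a, prod_encode (y, i))))) k)"
| mu: "partrec f \<Longrightarrow>
    partrec (\<lambda>a.
      if \<exists>n. f (prod_encode (a, n)) = Some 0 \<and> (\<forall>m<n. f (prod_encode (a, m)) \<noteq> None)
      then Some (LEAST n. f (prod_encode (a, n)) = Some 0) else None)"

definition recursive :: "(nat \<Rightarrow> nat) \<Rightarrow> bool" where
  "recursive f \<longleftrightarrow> partrec (\<lambda>n. Some (f n))"

definition recursive_set :: "nat set \<Rightarrow> bool" where
  "recursive_set A \<longleftrightarrow> recursive (\<lambda>n. if n \<in> A then 1 else 0)"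

definition re_set :: "nat set \<Rightarrow> bool" where
  "re_set A \<longleftrightarrow> (\<exists>f. partrec f \<and> A = dom f)"

definition Pi03 :: "nat set \<Rightarrow> bool" where
  "Pi03 A \<longleftrightarrow> (\<exists>R. recursive_set R \<and>
     A = {e. \<forall>x. \<exists>y. \<forall>z. prod_encode (e, prod_encode (x, prod_encode (y, z))) \<in> R})"

definition many_one_reducible :: "nat set \<Rightarrow> nat set \<Rightarrow> bool" where
  "many_one_reducible A B \<longleftrightarrow> (\<exists>f. recursive f \<and> (\<forall>n. n \<in> A \<longleftrightarrow> f n \<in> B))"

definition Pi3_hard :: "nat set \<Rightarrow> bool" where
  "Pi3_hard B \<longleftrightarrow> (\<forall>A. Pi03 A \<longrightarrow> many_one_reducible A B)"

definition recursive_rat_seq :: "(nat \<Rightarrow> rat) \<Rightarrow> bool" where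
  "recursive_rat_seq q \<longleftrightarrow> (\<exists>a b c. recursive a \<and> recursive b \<and> recursive c \<and>
     (\<forall>n. q n = (of_nat (a n) - of_nat (b n)) / (of_nat (c n) + 1)))"

definition left_re_real :: "real \<Rightarrow> bool" where
  "left_re_real r \<longleftrightarrow> r \<in> {0..1} \<and>
     (\<exists>q. recursive_rat_seq q \<and> mono q \<and> (\<lambda>n. real_of_rat (q n)) \<longlonglongrightarrow> r)"

definition binlen :: "nat \<Rightarrow> nat" where
  "binlen x = nat \<lceil>log 2 (real x + 1)\<rceil>"

text \<open>For an arbitrary domain the sum of the weights may exceed 1 or even diverge. As
  reals are numbers in $[0,1]$, a numbering has to keep all of its sums within this range.\<close>

definition left_re_numbering :: "(nat \<Rightarrow> real) \<Rightarrow> bool" where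
  "left_re_numbering \<alpha> \<longleftrightarrow> (\<exists>\<phi>. partrec \<phi> \<and>
     (\<forall>e. ((\<lambda>x. (1 / 2) ^ binlen x) has_sum \<alpha> e) {x. \<phi> (prod_encode (e, x)) \<noteq> None} \<and>
          \<alpha> e \<le> 1))"

definition universal_numbering :: "(nat \<Rightarrow> real) \<Rightarrow> bool" where
  "universal_numbering \<alpha> \<longleftrightarrow> (\<forall>r. left_re_real r \<longrightarrow> (\<exists>e. \<alpha> e = r))"

definition acceptable_numbering :: "(nat \<Rightarrow> real) \<Rightarrow> bool" where
  "acceptable_numbering \<alpha> \<longleftrightarrow>
     (\<forall>\<beta>. left_re_numbering \<beta> \<longrightarrow> (\<exists>f. recursive f \<and> (\<forall>e. \<alpha> (f e) = \<beta> e)))"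

text \<open>Lebesgue measure on infinite binary sequences is the fair-coin product measure.\<close>

definition cantor_measure :: "(nat \<Rightarrow> bool) measure" where
  "cantor_measure = PiM UNIV (\<lambda>_. measure_pmf (bernoulli_pmf (1 / 2)))"

definition string_code :: "bool list \<Rightarrow> nat" where
  "string_code \<sigma> = list_encode (map of_bool \<sigma>)"

definition cylinder :: "bool list \<Rightarrow> (nat \<Rightarrow> bool) set" where
  "cylinder \<sigma> = {X. \<forall>i < length \<sigma>. X i = \<sigma> ! i}"

definition Pi01_class :: "(nat \<Rightarrow> bool) set \<Rightarrow> bool" where
  "Pi01_class P \<longleftrightarrow> (\<exists>W. re_set W \<and> P = - (\<Union>\<sigma> \<in> {\<sigma>. string_code \<sigma> \<in> W}. cylinder \<sigma>))"

definition Kurtz_random :: "(nat \<Rightarrow> bool) \<Rightarrow> bool" where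
  "Kurtz_random X \<longleftrightarrow> \<not> (\<exists>P. Pi01_class P \<and> P \<in> null_sets cantor_measure \<and> X \<in> P)"

definition binary_value :: "(nat \<Rightarrow> bool) \<Rightarrow> real" where
  "binary_value X = (\<Sum>n. of_bool (X n) * (1 / 2) ^ Suc n)"

text \<open>The choice of the expansion does not matter: if a number has two binary expansions, both are
  eventually constant, hence form singleton $\Pi^0_1$ classes of measure zero, and neither is
  Kurtz random.\<close>

definition Kurtz_random_real :: "real \<Rightarrow> bool" where
  "Kurtz_random_real r \<longleftrightarrow> (\<exists>X. binary_value X = r \<and> Kurtz_random X)"

end

theory Submission
  imports Defs
begin

text \<open>Let \<open>A = {e. \<forall>x. \<exists>y. \<forall>z. R e x y z}\<close>. At stage \<open>s\<close> one builds a finite binary string level by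
  level. Level \<open>x\<close> appends \<open>1\<^sup>n 0\<close>, where \<open>n\<close> is the current guess at the least \<open>y\<close> with
  \<open>\<forall>z. R e x y z\<close>; these guesses grow with \<open>s\<close> and stay bounded iff such a \<open>y\<close> exists. Level \<open>x\<close> then
  appends \<open>0\<close>, until an extension of the string by some \<open>1\<tau>\<close> is found that lies in the
  \<open>x\<close>-th effectively open set; from then on it appends that \<open>1\<tau>\<close>. Every change moves to the
  right, so the limit of the strings is a left-r.e. real, uniformly in \<open>e\<close>. If \<open>e \<in> A\<close>, every
  level stabilises and the limit enters every effectively open set of full measure, since such a set is dense;
  so it is Kurtz random. If \<open>e \<notin> A\<close> and \<open>x\<close> is the first level with unbounded guesses, the limit is
  \<open>\<rho> 1 1 1 \<dots>\<close> for the stable string \<open>\<rho>\<close> below level \<open>x\<close>, hence dyadic and not Kurtz random.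
  Acceptability turns the uniform construction into a many-one reduction.\<close>

section \<open>Recursive functions\<close>

abbreviation pfst :: "nat \<Rightarrow> nat" where "pfst n \<equiv> fst (prod_decode n)"
abbreviation psnd :: "nat \<Rightarrow> nat" where "psnd n \<equiv> snd (prod_decode n)"
abbreviation pe :: "nat \<Rightarrow> nat \<Rightarrow> nat" where "pe a b \<equiv> prod_encode (a, b)"

lemma recursive_comp:
  assumes "recursive f" "recursive g"
  shows "recursive (\<lambda>n. f (g n))"
  using partrec.comp[of "\<lambda>n. Some (f n)" "\<lambda>n. Some (g n)"] assms by (simp add: recursive_def)

named_theorems rec_intro

lemma recursive_pe [rec_intro]:
  assumes "recursive f" "recursive g"
  shows "recursive (\<lambda>n. pe (f n) (g n))"
  using partrec.pair[of "\<lambda>n. Some (f n)" "\<lambda>n. Some (g n)"] assms by (simp add: recursive_def)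

lemma recursive_pfst [rec_intro]: "recursive f \<Longrightarrow> recursive (\<lambda>n. pfst (f n))"
  using recursive_comp partrec.proj1 by (auto simp: recursive_def)

lemma recursive_psnd [rec_intro]: "recursive f \<Longrightarrow> recursive (\<lambda>n. psnd (f n))"
  using recursive_comp partrec.proj2 by (auto simp: recursive_def)

lemma recursive_Suc [rec_intro]: "recursive f \<Longrightarrow> recursive (\<lambda>n. Suc (f n))"
  using recursive_comp partrec.succ by (auto simp: recursive_def)

text \<open>The identity is not among the clauses of \<open>partrec\<close>; it arises by pairing
  the two projections again.\<close>

lemma recursive_id [rec_intro]: "recursive (\<lambda>n. n)"
proof -
  have "recursive (\<lambda>n. pe (pfst n) (psnd n))"
    by (rule recursive_pe) (simp_all add: recursive_def partrec.proj1 partrec.proj2)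
  then show ?thesis by simp
qed

lemma recursive_const [rec_intro]: "recursive (\<lambda>n. c)"
proof (induction c)
  case 0
  show ?case by (simp add: recursive_def partrec.zero)
next
  case (Suc c)
  then show ?case by (rule recursive_Suc)
qed

lemma recursive_comp2:
  assumes "recursive (\<lambda>m. h (pfst m) (psnd m))" "recursive f" "recursive g"
  shows "recursive (\<lambda>n. h (f n) (g n))"
  using recursive_comp[OF assms(1) recursive_pe[OF assms(2,3)]] by simp

lemma recursive_comp3:
  assumes "recursive (\<lambda>m. h (pfst m) (pfst (psnd m)) (psnd (psnd m)))"
    "recursive f" "recursive g" "recursive k"
  shows "recursive (\<lambda>n. h (f n) (g n) (k n))"
  using recursive_comp[OF assms(1) recursive_pe[OF assms(2) recursive_pe[OF assms(3,4)]]] by simp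

text \<open>The clause \<open>prec\<close> hands its parameter on to the step function, so
  \<open>g\<close> may depend on \<open>n\<close>; composing with \<open>n\<close> paired with
  \<open>h n\<close> gives the general form.\<close>

lemma recursive_rec_nat [rec_intro]:
  assumes "recursive f" "recursive (\<lambda>m. g (pfst m) (pfst (psnd m)) (psnd (psnd m)))" "recursive h"
  shows "recursive (\<lambda>n. rec_nat (f n) (\<lambda>y r. g n y r) (h n))"
proof -
  let ?F = "\<lambda>n. Some (f n)"
  let ?G = "\<lambda>m. Some (g (pfst m) (pfst (psnd m)) (psnd (psnd m)))"
  have eq: "rec_nat (?F a) (\<lambda>y r. Option.bind r (\<lambda>i. ?G (pe a (pe y i)))) k
        = Some (rec_nat (f a) (\<lambda>y r. g a y r) k)" for a k
    by (induction k) auto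
  have "partrec (\<lambda>n. case prod_decode n of (a, k) \<Rightarrow>
      rec_nat (?F a) (\<lambda>y r. Option.bind r (\<lambda>i. ?G (pe a (pe y i)))) k)"
    by (rule partrec.prec) (use assms in \<open>auto simp: recursive_def\<close>)
  then have "recursive (\<lambda>m. rec_nat (f (pfst m)) (\<lambda>y r. g (pfst m) y r) (psnd m))"
    unfolding eq by (simp add: recursive_def case_prod_beta)
  from recursive_comp2[OF this recursive_id assms(3)] show ?thesis .
qed

section \<open>Arithmetic by primitive recursion\<close>

lemma recursive_add [rec_intro]:
  assumes "recursive f" "recursive g"
  shows "recursive (\<lambda>n. f n + g n)"
proof -
  have "recursive (\<lambda>n. rec_nat (f n) (\<lambda>y r. Suc r) (g n))"
    by (intro rec_intro assms)
  moreover have "rec_nat a (\<lambda>y r. Suc r) b = a + b" for a b by (induction b) auto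
  ultimately show ?thesis by simp
qed

lemma recursive_mult [rec_intro]:
  assumes "recursive f" "recursive g"
  shows "recursive (\<lambda>n. f n * g n)"
proof -
  have "recursive (\<lambda>n. rec_nat 0 (\<lambda>y r. r + f n) (g n))"
    by (intro rec_intro assms recursive_comp[OF assms(1)])
  moreover have "rec_nat 0 (\<lambda>y r. r + a) b = a * b" for a b :: nat by (induction b) auto
  ultimately show ?thesis by simp
qed

lemma recursive_power [rec_intro]:
  assumes "recursive f" "recursive g"
  shows "recursive (\<lambda>n. f n ^ g n)"
proof -
  have "recursive (\<lambda>n. rec_nat 1 (\<lambda>y r. r * f n) (g n))"
    by (intro rec_intro assms recursive_comp[OF assms(1)])
  moreover have "rec_nat 1 (\<lambda>y r. r * a) b = a ^ b" for a b :: nat by (induction b) auto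
  ultimately show ?thesis by simp
qed

lemma recursive_diff [rec_intro]:
  assumes "recursive f" "recursive g"
  shows "recursive (\<lambda>n. f n - g n)"
proof -
  \<comment> \<open>The inner \<open>rec_nat\<close> is the predecessor function, with value 0 at 0,
    as truncated subtraction requires.\<close>
  have "recursive (\<lambda>n. rec_nat (f n) (\<lambda>y r. rec_nat 0 (\<lambda>y r. y) r) (g n))"
    by (intro rec_intro assms)
  moreover have "rec_nat a (\<lambda>y r. rec_nat 0 (\<lambda>y r. y) r) b = a - b" for a b :: nat
  proof (induction b)
    case (Suc b)
    have "rec_nat 0 (\<lambda>y r. y) k = k - 1" for k :: nat by (cases k) auto
    with Suc show ?case by simp
  qed auto
  ultimately show ?thesis by simp
qed

lemma recursive_sum [rec_intro]:
  assumes "recursive (\<lambda>m. g (pfst m) (psnd m))" "recursive h"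
  shows "recursive (\<lambda>n. \<Sum>i<h n. g n i)"
proof -
  have "recursive (\<lambda>n. rec_nat 0 (\<lambda>y r. r + g n y) (h n))"
    by (intro rec_intro assms recursive_comp2[OF assms(1)])
  moreover have "rec_nat 0 (\<lambda>y r. r + g n y) b = (\<Sum>i<b. g n i)" for n b by (induction b) auto
  ultimately show ?thesis by simp
qed

section \<open>Decidable predicates\<close>

definition recursive_pred :: "(nat \<Rightarrow> bool) \<Rightarrow> bool" where
  "recursive_pred P \<longleftrightarrow> recursive (\<lambda>n. of_bool (P n))"

lemma recursive_of_bool [rec_intro]: "recursive_pred P \<Longrightarrow> recursive (\<lambda>n. of_bool (P n))"
  by (simp add: recursive_pred_def)

lemma recursive_pred_comp3:
  assumes "recursive_pred (\<lambda>m. P (pfst m) (pfst (psnd m)) (psnd (psnd m)))"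
    "recursive f" "recursive g" "recursive k"
  shows "recursive_pred (\<lambda>n. P (f n) (g n) (k n))"
  using recursive_comp3[of "\<lambda>x y z. of_bool (P x y z)"] assms by (simp add: recursive_pred_def)

lemma recursive_pred_not [rec_intro]:
  assumes "recursive_pred P"
  shows "recursive_pred (\<lambda>n. \<not> P n)"
proof -
  have "recursive (\<lambda>n. 1 - of_bool (P n))"
    by (intro rec_intro assms)
  moreover have "(1 - of_bool b :: nat) = of_bool (\<not> b)" for b by simp
  ultimately show ?thesis by (simp only: recursive_pred_def)
qed

lemma recursive_pred_conj [rec_intro]:
  assumes "recursive_pred P" "recursive_pred Q"
  shows "recursive_pred (\<lambda>n. P n \<and> Q n)"
proof -
  have "recursive (\<lambda>n. of_bool (P n) * of_bool (Q n))"
    by (intro rec_intro assms)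
  then show ?thesis by (simp add: recursive_pred_def of_bool_conj)
qed

lemma recursive_pred_disj [rec_intro]:
  assumes "recursive_pred P" "recursive_pred Q"
  shows "recursive_pred (\<lambda>n. P n \<or> Q n)"
proof -
  have "recursive_pred (\<lambda>n. \<not> (\<not> P n \<and> \<not> Q n))"
    by (intro rec_intro assms)
  then show ?thesis by simp
qed

lemma recursive_pred_le [rec_intro]:
  assumes "recursive f" "recursive g"
  shows "recursive_pred (\<lambda>n. f n \<le> g n)"
proof -
  have "recursive (\<lambda>n. 1 - (f n - g n))"
    by (intro rec_intro assms)
  moreover have "1 - (a - b) = of_bool (a \<le> b)" for a b :: nat by auto
  ultimately show ?thesis by (simp add: recursive_pred_def)
qed

lemma recursive_pred_less [rec_intro]:
  assumes "recursive f" "recursive g"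
  shows "recursive_pred (\<lambda>n. f n < g n)"
proof -
  have "recursive_pred (\<lambda>n. \<not> g n \<le> f n)"
    by (intro rec_intro assms)
  then show ?thesis by (simp add: not_le)
qed

lemma recursive_pred_eq [rec_intro]:
  assumes "recursive f" "recursive g"
  shows "recursive_pred (\<lambda>n. f n = g n)"
proof -
  have "recursive_pred (\<lambda>n. f n \<le> g n \<and> g n \<le> f n)"
    by (intro rec_intro assms)
  then show ?thesis by (simp add: order_eq_iff)
qed

lemma recursive_pred_ball [rec_intro]:
  assumes "recursive_pred (\<lambda>m. P (pfst m) (psnd m))" "recursive h"
  shows "recursive_pred (\<lambda>n. \<forall>i<h n. P n i)"
proof -
  \<comment> \<open>The sum counts the counterexamples below the bound.\<close>
  have "recursive_pred (\<lambda>n. (\<Sum>i<h n. of_bool (\<not> P n i)) = (0::nat))"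
    by (intro rec_intro assms)
  moreover have "(\<Sum>i<h n. of_bool (\<not> P n i)) = (0::nat) \<longleftrightarrow> (\<forall>i<h n. P n i)" for n
    by (auto simp: of_bool_def)
  ultimately show ?thesis by simp
qed

lemma recursive_pred_bex [rec_intro]:
  assumes "recursive_pred (\<lambda>m. P (pfst m) (psnd m))" "recursive h"
  shows "recursive_pred (\<lambda>n. \<exists>i<h n. P n i)"
proof -
  have "recursive_pred (\<lambda>n. \<not> (\<forall>i<h n. \<not> P n i))"
    by (intro rec_intro assms)
  then show ?thesis by simp
qed

lemma recursive_if [rec_intro]:
  assumes "recursive_pred P" "recursive f" "recursive g"
  shows "recursive (\<lambda>n. if P n then f n else g n)"
proof -
  have "recursive (\<lambda>n. of_bool (P n) * f n + of_bool (\<not> P n) * g n)"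
    by (intro rec_intro assms)
  moreover have "of_bool b * x + of_bool (\<not> b) * y = (if b then x else y)" for b and x y :: nat
    by simp
  ultimately show ?thesis by simp
qed

lemma recursive_pred_if [rec_intro]:
  assumes "recursive_pred P" "recursive_pred f" "recursive_pred g"
  shows "recursive_pred (\<lambda>n. if P n then f n else g n)"
proof -
  have "recursive_pred (\<lambda>n. (P n \<and> f n) \<or> (\<not> P n \<and> g n))"
    by (intro rec_intro assms)
  moreover have "(\<lambda>n. (P n \<and> f n) \<or> (\<not> P n \<and> g n)) = (\<lambda>n. if P n then f n else g n)" by auto
  ultimately show ?thesis by simp
qed

section \<open>Minimisation and division\<close>

text \<open>The function minimised is the characteristic function of the negation. It is total, so
  the definedness condition in the clause \<open>mu\<close> holds trivially. The domains of
  enumerations below are obtained in this way.\<close>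

lemma partrec_least:
  assumes "recursive_pred (\<lambda>m. P (pfst m) (psnd m))"
  shows "partrec (\<lambda>n. if \<exists>y. P n y then Some (LEAST y. P n y) else None)"
proof -
  have "partrec (\<lambda>m. Some (of_bool (\<not> P (pfst m) (psnd m))))"
    using recursive_pred_not[OF assms] by (simp only: recursive_pred_def recursive_def)
  moreover have "Some (of_bool (\<not> b)) = Some (0::nat) \<longleftrightarrow> b" for b by simp
  ultimately show ?thesis
    using partrec.mu[of "\<lambda>m. Some (of_bool (\<not> P (pfst m) (psnd m)))"]
    by (simp only: prod_encode_inverse fst_conv snd_conv option.simps simp_thms)
qed

lemma recursive_least [rec_intro]:
  assumes "recursive_pred (\<lambda>m. P (pfst m) (psnd m))" "\<And>n. \<exists>y. P n y"
  shows "recursive (\<lambda>n. LEAST y. P n y)"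
  using partrec_least[OF assms(1)] assms(2) by (simp add: recursive_def)

lemma recursive_div [rec_intro]:
  assumes "recursive f" "recursive g"
  shows "recursive (\<lambda>n. f n div g n)"
proof -
  \<comment> \<open>The disjunct \<open>g n = 0\<close> makes the search total and yields 0, which
    agrees with division by zero in HOL.\<close>
  have ex: "\<exists>q. g n = 0 \<or> f n < Suc q * g n" for n
    by (metis dividend_less_div_times mult_Suc not_gr_zero)
  have "recursive (\<lambda>n. LEAST q. g n = 0 \<or> f n < Suc q * g n)"
    by (intro rec_intro ex recursive_comp[OF assms(1)] recursive_comp[OF assms(2)])
  moreover have "(LEAST q. b = 0 \<or> a < Suc q * b) = a div b" for a b :: nat
  proof (rule Least_equality)
    show "b = 0 \<or> a < Suc (a div b) * b"
      by (metis dividend_less_div_times mult_Suc not_gr_zero)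
    show "a div b \<le> y" if "b = 0 \<or> a < Suc y * b" for y
      using that by (metis div_by_0 le0 less_Suc_eq_le less_mult_imp_div_less)
  qed
  ultimately show ?thesis by simp
qed

lemma recursive_mod [rec_intro]:
  assumes "recursive f" "recursive g"
  shows "recursive (\<lambda>n. f n mod g n)"
proof -
  have "recursive (\<lambda>n. f n - f n div g n * g n)"
    by (intro rec_intro assms)
  then show ?thesis by (simp add: minus_div_mult_eq_mod)
qed

lemma recursive_pred_odd [rec_intro]:
  assumes "recursive f"
  shows "recursive_pred (\<lambda>n. odd (f n))"
proof -
  have "recursive_pred (\<lambda>n. f n mod 2 = 1)"
    by (intro rec_intro assms)
  then show ?thesis by (simp add: odd_iff_mod_2_eq_one)
qed

lemma recursive_pred_set_decode [rec_intro]: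
  assumes "recursive f" "recursive g"
  shows "recursive_pred (\<lambda>n. f n \<in> set_decode (g n))"
  unfolding set_decode_def mem_Collect_eq by (intro rec_intro assms)

section \<open>A universal evaluation relation\<close>

text \<open>A program is coded as \<open>pe k (pe f g)\<close>, where \<open>k\<close> numbers the clauses of \<^const>\<open>partrec\<close> and
  \<open>f\<close>, \<open>g\<close> are the codes of its parts; \<open>D\<close> codes a finite set of triples \<open>pe c (pe n y)\<close>, read as
  program \<open>c\<close> maps \<open>n\<close> to \<open>y\<close>. The bound \<open>b\<close> keeps the relation decidable. The union of the stages is a
  fixed point of the clauses; that it is the least one is never needed, as the only self-reference
  is primitive recursion, which descends in its counter.\<close>

definition eval_step :: "nat \<Rightarrow> nat \<Rightarrow> nat \<Rightarrow> bool" where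
  "eval_step b D q \<longleftrightarrow>
    (let c = pfst q; n = pfst (psnd q); y = psnd (psnd q); k = pfst c; f = pfst (psnd c); g = psnd (psnd c)
     in (k = 0 \<and> y = 0)
      \<or> (k = 1 \<and> y = Suc n)
      \<or> (k = 2 \<and> y = pfst n)
      \<or> (k = 3 \<and> y = psnd n)
      \<or> (k = 4 \<and> (\<exists>u<b. \<exists>v<b. pe f (pe n u) \<in> set_decode D \<and> pe g (pe n v) \<in> set_decode D
                        \<and> y = pe u v))
      \<or> (k = 5 \<and> (\<exists>u<b. pe g (pe n u) \<in> set_decode D \<and> pe f (pe u y) \<in> set_decode D))
      \<or> (k = 6 \<and> (if psnd n = 0 then pe f (pe (pfst n) y) \<in> set_decode D
           else (\<exists>i<b. pe c (pe (pe (pfst n) (psnd n - 1)) i) \<in> set_decode D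
                   \<and> pe g (pe (pe (pfst n) (pe (psnd n - 1) i)) y) \<in> set_decode D)))
      \<or> (k = 7 \<and> pe f (pe (pe n y) 0) \<in> set_decode D
           \<and> (\<forall>m<y. \<exists>v<b. 0 < v \<and> pe f (pe (pe n m) v) \<in> set_decode D)))"

text \<open>The sum is the bit mask of a finite set, to be read by \<open>set_decode\<close>. The
  stage number is both the bound inside the clauses and the cutoff for new triples, so all stages
  are finite and computed by one primitive recursion.\<close>

definition eval_stage :: "nat \<Rightarrow> nat" where
  "eval_stage t = rec_nat 0 (\<lambda>t D. \<Sum>q<t. of_bool (eval_step t D q) * 2 ^ q) t"

lemma recursive_pred_eval_step [rec_intro]:
  assumes "recursive b" "recursive D" "recursive q"
  shows "recursive_pred (\<lambda>n. eval_step (b n) (D n) (q n))"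
proof -
  have "recursive_pred (\<lambda>m. eval_step (pfst m) (pfst (psnd m)) (psnd (psnd m)))"
    unfolding eval_step_def Let_def by (intro rec_intro)
  then show ?thesis by (rule recursive_pred_comp3) fact+
qed

lemma recursive_eval_stage [rec_intro]:
  assumes "recursive t"
  shows "recursive (\<lambda>n. eval_stage (t n))"
  unfolding eval_stage_def by (intro rec_intro assms)

lemma set_decode_sum_of_bool:
  "set_decode (\<Sum>q<t. of_bool (P q) * 2 ^ q) = {q. q < t \<and> P q}"
proof -
  have "(\<Sum>q<t. of_bool (P q) * 2 ^ q) = set_encode {q. q < t \<and> P q}"
    unfolding set_encode_def
    by (rule sum.mono_neutral_cong_right) auto
  then show ?thesis by (simp add: set_encode_inverse)
qed

lemma set_decode_eval_stage_Suc:
  "set_decode (eval_stage (Suc t)) = {q. q < t \<and> eval_step t (eval_stage t) q}"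
  by (simp only: eval_stage_def nat.rec set_decode_sum_of_bool)

text \<open>The clauses use \<open>D\<close> only positively and \<open>b\<close> only to bound
  existential quantifiers; the universal quantifier of minimisation is bounded by
  \<open>y\<close>.\<close>

lemma eval_step_mono:
  assumes "eval_step b D q" "b \<le> b'" "set_decode D \<subseteq> set_decode D'"
  shows "eval_step b' D' q"
proof -
  have D: "\<And>x. x \<in> set_decode D \<Longrightarrow> x \<in> set_decode D'" and b: "\<And>u. u < b \<Longrightarrow> u < b'"
    using assms(2,3) by auto
  from assms(1) show ?thesis
    unfolding eval_step_def Let_def
    by (elim disj_forward) (assumption | metis D b)+
qed

lemma eval_stage_mono_Suc: "set_decode (eval_stage t) \<subseteq> set_decode (eval_stage (Suc t))"
proof (induction t)
  case 0
  show ?case by (simp add: eval_stage_def)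
next
  case (Suc t)
  have "eval_step (Suc t) (eval_stage (Suc t)) q" if "eval_step t (eval_stage t) q" for q
    using that by (rule eval_step_mono) (use Suc in auto)
  then show ?case
    unfolding set_decode_eval_stage_Suc[of t] set_decode_eval_stage_Suc[of "Suc t"] by auto
qed

lemma eval_stage_mono: "s \<le> t \<Longrightarrow> set_decode (eval_stage s) \<subseteq> set_decode (eval_stage t)"
  by (rule lift_Suc_mono_le) (use eval_stage_mono_Suc in auto)

definition evals :: "nat \<Rightarrow> nat \<Rightarrow> nat \<Rightarrow> bool" where
  "evals c n y \<longleftrightarrow> (\<exists>t. pe c (pe n y) \<in> set_decode (eval_stage t))"

text \<open>By monotonicity the step can be repeated at a stage beyond \<open>b\<close>,
  \<open>t\<close> and the code of the triple itself, where the cutoff no longer excludes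
  it.\<close>

lemma evals_if_step:
  assumes "eval_step b (eval_stage t) (pe c (pe n y))"
  shows "evals c n y"
proof -
  let ?q = "pe c (pe n y)"
  define s where "s = Suc (max t (max b ?q))"
  have "eval_step s (eval_stage s) ?q"
    by (rule eval_step_mono[OF assms]) (auto simp: s_def intro!: eval_stage_mono)
  moreover have "?q < s" by (simp add: s_def)
  ultimately have "?q \<in> set_decode (eval_stage (Suc s))"
    by (simp add: set_decode_eval_stage_Suc)
  then show ?thesis by (auto simp: evals_def)
qed

lemma evals_stepE:
  assumes "evals c n y"
  obtains b t where "eval_step b (eval_stage t) (pe c (pe n y))"
proof -
  obtain t where "pe c (pe n y) \<in> set_decode (eval_stage t)"
    using assms by (auto simp: evals_def)
  then have "pe c (pe n y) \<in> set_decode (eval_stage (Suc t))"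
    using eval_stage_mono_Suc by blast
  then show ?thesis using that by (auto simp: set_decode_eval_stage_Suc)
qed

lemma evalsI: "pe c (pe n y) \<in> set_decode (eval_stage t) \<Longrightarrow> evals c n y"
  by (auto simp: evals_def)

text \<open>Phrased with \<open>eventually\<close> so that finitely many evaluations can be brought
  to a common stage; \<open>y < t\<close> makes the outputs fit under the bound of the
  clauses.\<close>

lemma eventually_evals:
  assumes "evals c n y"
  shows "eventually (\<lambda>t. y < t \<and> pe c (pe n y) \<in> set_decode (eval_stage t)) sequentially"
proof -
  obtain t where "pe c (pe n y) \<in> set_decode (eval_stage t)"
    using assms by (auto simp: evals_def)
  then have "y < u \<and> pe c (pe n y) \<in> set_decode (eval_stage u)" if "u \<ge> max t (Suc y)" for u
    using that eval_stage_mono[of t u] by auto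
  then show ?thesis unfolding eventually_sequentially by blast
qed

section \<open>Evaluation satisfies the clauses of the partial recursive functions\<close>

lemma evals_zero: "evals (pe 0 (pe f g)) n y \<longleftrightarrow> y = 0"
proof
  assume "evals (pe 0 (pe f g)) n y"
  then show "y = 0" by (elim evals_stepE) (simp add: eval_step_def)
qed (rule evals_if_step, simp add: eval_step_def)

lemma evals_succ: "evals (pe 1 (pe f g)) n y \<longleftrightarrow> y = Suc n"
proof
  assume "evals (pe 1 (pe f g)) n y"
  then show "y = Suc n" by (elim evals_stepE) (simp add: eval_step_def)
qed (rule evals_if_step, simp add: eval_step_def)

lemma evals_proj1: "evals (pe 2 (pe f g)) n y \<longleftrightarrow> y = pfst n"
proof
  assume "evals (pe 2 (pe f g)) n y"
  then show "y = pfst n" by (elim evals_stepE) (simp add: eval_step_def)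
qed (rule evals_if_step, simp add: eval_step_def)

lemma evals_proj2: "evals (pe 3 (pe f g)) n y \<longleftrightarrow> y = psnd n"
proof
  assume "evals (pe 3 (pe f g)) n y"
  then show "y = psnd n" by (elim evals_stepE) (simp add: eval_step_def)
qed (rule evals_if_step, simp add: eval_step_def)

lemma evals_pair:
  "evals (pe 4 (pe f g)) n y \<longleftrightarrow> (\<exists>u v. evals f n u \<and> evals g n v \<and> y = pe u v)"
proof
  assume "evals (pe 4 (pe f g)) n y"
  then show "\<exists>u v. evals f n u \<and> evals g n v \<and> y = pe u v"
    by (elim evals_stepE) (auto simp: eval_step_def intro: evalsI)
next
  assume "\<exists>u v. evals f n u \<and> evals g n v \<and> y = pe u v"
  then obtain u v where uv: "evals f n u" "evals g n v" "y = pe u v" by blast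
  from eventually_happens[OF eventually_conj[OF eventually_evals[OF uv(1)] eventually_evals[OF uv(2)]]]
  obtain t where "u < t" "pe f (pe n u) \<in> set_decode (eval_stage t)"
    "v < t" "pe g (pe n v) \<in> set_decode (eval_stage t)" by auto
  then have "eval_step t (eval_stage t) (pe (pe 4 (pe f g)) (pe n y))"
    using uv(3) by (auto simp: eval_step_def)
  then show "evals (pe 4 (pe f g)) n y" by (rule evals_if_step)
qed

lemma evals_comp:
  "evals (pe 5 (pe f g)) n y \<longleftrightarrow> (\<exists>u. evals g n u \<and> evals f u y)"
proof
  assume "evals (pe 5 (pe f g)) n y"
  then show "\<exists>u. evals g n u \<and> evals f u y"
    by (elim evals_stepE) (auto simp: eval_step_def intro: evalsI)
next
  assume "\<exists>u. evals g n u \<and> evals f u y"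
  then obtain u where u: "evals g n u" "evals f u y" by blast
  from eventually_happens[OF eventually_conj[OF eventually_evals[OF u(1)] eventually_evals[OF u(2)]]]
  obtain t where "u < t" "pe g (pe n u) \<in> set_decode (eval_stage t)"
    "pe f (pe u y) \<in> set_decode (eval_stage t)" by auto
  then have "eval_step t (eval_stage t) (pe (pe 5 (pe f g)) (pe n y))"
    by (auto simp: eval_step_def)
  then show "evals (pe 5 (pe f g)) n y" by (rule evals_if_step)
qed

lemma evals_prec_0: "evals (pe 6 (pe f g)) (pe a 0) y \<longleftrightarrow> evals f a y"
proof
  assume "evals (pe 6 (pe f g)) (pe a 0) y"
  then show "evals f a y" by (elim evals_stepE) (auto simp: eval_step_def intro: evalsI)
next
  assume "evals f a y"
  from eventually_happens[OF eventually_evals[OF this]]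
  obtain t where "pe f (pe a y) \<in> set_decode (eval_stage t)" by auto
  then have "eval_step t (eval_stage t) (pe (pe 6 (pe f g)) (pe (pe a 0) y))"
    by (auto simp: eval_step_def)
  then show "evals (pe 6 (pe f g)) (pe a 0) y" by (rule evals_if_step)
qed

lemma evals_prec_Suc:
  "evals (pe 6 (pe f g)) (pe a (Suc k)) y \<longleftrightarrow>
    (\<exists>i. evals (pe 6 (pe f g)) (pe a k) i \<and> evals g (pe a (pe k i)) y)"
proof
  assume "evals (pe 6 (pe f g)) (pe a (Suc k)) y"
  then show "\<exists>i. evals (pe 6 (pe f g)) (pe a k) i \<and> evals g (pe a (pe k i)) y"
    by (elim evals_stepE) (auto simp: eval_step_def intro: evalsI)
next
  assume "\<exists>i. evals (pe 6 (pe f g)) (pe a k) i \<and> evals g (pe a (pe k i)) y"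
  then obtain i where i: "evals (pe 6 (pe f g)) (pe a k) i" "evals g (pe a (pe k i)) y" by blast
  from eventually_happens[OF eventually_conj[OF eventually_evals[OF i(1)] eventually_evals[OF i(2)]]]
  obtain t where "i < t" "pe (pe 6 (pe f g)) (pe (pe a k) i) \<in> set_decode (eval_stage t)"
    "pe g (pe (pe a (pe k i)) y) \<in> set_decode (eval_stage t)" by auto
  then have "eval_step t (eval_stage t) (pe (pe 6 (pe f g)) (pe (pe a (Suc k)) y))"
    by (auto simp: eval_step_def)
  then show "evals (pe 6 (pe f g)) (pe a (Suc k)) y" by (rule evals_if_step)
qed

lemma evals_mu:
  "evals (pe 7 (pe f g)) n y \<longleftrightarrow>
    evals f (pe n y) 0 \<and> (\<forall>m<y. \<exists>v>0. evals f (pe n m) v)"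
proof
  assume "evals (pe 7 (pe f g)) n y"
  then show "evals f (pe n y) 0 \<and> (\<forall>m<y. \<exists>v>0. evals f (pe n m) v)"
    by (elim evals_stepE) (simp add: eval_step_def, meson evalsI)
next
  assume asm: "evals f (pe n y) 0 \<and> (\<forall>m<y. \<exists>v>0. evals f (pe n m) v)"
  then obtain v where v: "0 < v m \<and> evals f (pe n m) (v m)" if "m < y" for m by metis
  have "eventually (\<lambda>t. \<forall>m\<in>{..<y}. v m < t \<and> pe f (pe (pe n m) (v m)) \<in> set_decode (eval_stage t)) sequentially"
    by (intro eventually_ball_finite) (use v eventually_evals in auto)
  from eventually_happens[OF eventually_conj[OF this eventually_evals[OF conjunct1[OF asm]]]]
  obtain t where "\<forall>m<y. v m < t \<and> pe f (pe (pe n m) (v m)) \<in> set_decode (eval_stage t)"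
    "pe f (pe (pe n y) 0) \<in> set_decode (eval_stage t)" by auto
  then have "eval_step t (eval_stage t) (pe (pe 7 (pe f g)) (pe n y))"
    using v by (auto simp: eval_step_def)
  then show "evals (pe 7 (pe f g)) n y" by (rule evals_if_step)
qed

text \<open>Codes number all effectively open sets, so level \<open>c\<close> of the construction
  can be devoted to program \<open>c\<close>.\<close>

theorem partrec_imp_evals:
  assumes "partrec f"
  obtains c where "\<And>n y. f n = Some y \<longleftrightarrow> evals c n y"
proof -
  from assms have "\<exists>c. \<forall>n y. f n = Some y \<longleftrightarrow> evals c n y"
  proof (induction rule: partrec.induct)
    case zero
    have "\<forall>n y. Some 0 = Some y \<longleftrightarrow> evals (pe 0 (pe 0 0)) n y" by (auto simp: evals_zero)
    then show ?case by blast
  next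
    case succ
    have "\<forall>n y. Some (Suc n) = Some y \<longleftrightarrow> evals (pe 1 (pe 0 0)) n y" by (simp only: evals_succ) auto
    then show ?case by blast
  next
    case proj1
    have "\<forall>n y. Some (pfst n) = Some y \<longleftrightarrow> evals (pe 2 (pe 0 0)) n y" by (auto simp: evals_proj1)
    then show ?case by blast
  next
    case proj2
    have "\<forall>n y. Some (psnd n) = Some y \<longleftrightarrow> evals (pe 3 (pe 0 0)) n y" by (auto simp: evals_proj2)
    then show ?case by blast
  next
    case (pair f g)
    then obtain c d where "\<forall>n y. f n = Some y \<longleftrightarrow> evals c n y" "\<forall>n y. g n = Some y \<longleftrightarrow> evals d n y"
      by blast
    then have "\<forall>n y. Option.bind (f n) (\<lambda>a. Option.bind (g n) (\<lambda>b. Some (pe a b))) = Some y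
        \<longleftrightarrow> evals (pe 4 (pe c d)) n y"
      by (auto simp: evals_pair bind_eq_Some_conv)
    then show ?case by blast
  next
    case (comp f g)
    then obtain c d where "\<forall>n y. f n = Some y \<longleftrightarrow> evals c n y" "\<forall>n y. g n = Some y \<longleftrightarrow> evals d n y"
      by blast
    then have "\<forall>n y. Option.bind (g n) f = Some y \<longleftrightarrow> evals (pe 5 (pe c d)) n y"
      by (auto simp: evals_comp bind_eq_Some_conv)
    then show ?case by blast
  next
    case (prec f g)
    then obtain c d where cd: "\<And>n y. f n = Some y \<longleftrightarrow> evals c n y" "\<And>n y. g n = Some y \<longleftrightarrow> evals d n y"
      by blast
    have "rec_nat (f a) (\<lambda>y r. Option.bind r (\<lambda>i. g (pe a (pe y i)))) k = Some z
        \<longleftrightarrow> evals (pe 6 (pe c d)) (pe a k) z" for a k z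
      by (induction k arbitrary: z) (simp_all add: evals_prec_0 evals_prec_Suc cd bind_eq_Some_conv)
    then have "\<forall>n z. (case prod_decode n of (a, k) \<Rightarrow>
        rec_nat (f a) (\<lambda>y r. Option.bind r (\<lambda>i. g (pe a (pe y i)))) k) = Some z
        \<longleftrightarrow> evals (pe 6 (pe c d)) n z"
      by (simp add: case_prod_beta)
    then show ?case by blast
  next
    case (mu f)
    then obtain c where c: "\<And>n y. f n = Some y \<longleftrightarrow> evals c n y" by blast
    have "(if \<exists>n. f (pe a n) = Some 0 \<and> (\<forall>m<n. f (pe a m) \<noteq> None)
          then Some (LEAST n. f (pe a n) = Some 0) else None) = Some y
        \<longleftrightarrow> evals (pe 7 (pe c 0)) a y" (is "?L = Some y \<longleftrightarrow> _") for a y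
    proof
      assume L: "?L = Some y"
      then have ex: "\<exists>n. f (pe a n) = Some 0 \<and> (\<forall>m<n. f (pe a m) \<noteq> None)"
        and y: "y = (LEAST n. f (pe a n) = Some 0)" by (auto split: if_splits)
      from ex obtain n where n: "f (pe a n) = Some 0" "\<forall>m<n. f (pe a m) \<noteq> None" by blast
      have "f (pe a y) = Some 0" unfolding y using n(1) by (rule LeastI)
      moreover have "\<exists>v>0. f (pe a m) = Some v" if "m < y" for m
      proof -
        have "f (pe a m) \<noteq> Some 0" using that unfolding y by (rule not_less_Least)
        \<comment> \<open>The \<open>LEAST\<close> in the clause ignores definedness; comparison
          with \<open>n\<close>, below which everything is defined, shows that all values before
          \<open>y\<close> exist.\<close>
        moreover have "y \<le> n" unfolding y using n(1) by (rule Least_le)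
        ultimately show ?thesis using n(2)[rule_format, of m] that by (cases "f (pe a m)") auto
      qed
      ultimately show "evals (pe 7 (pe c 0)) a y" by (simp add: evals_mu c)
    next
      assume "evals (pe 7 (pe c 0)) a y"
      then have y: "f (pe a y) = Some 0" and lt: "\<And>m. m < y \<Longrightarrow> \<exists>v>0. f (pe a m) = Some v"
        by (simp_all add: evals_mu c)
      have "(LEAST n. f (pe a n) = Some 0) = y"
      proof (rule Least_equality)
        show "y \<le> z" if "f (pe a z) = Some 0" for z
          using lt[of z] that by (cases "z < y") auto
      qed (rule y)
      moreover have "\<exists>n. f (pe a n) = Some 0 \<and> (\<forall>m<n. f (pe a m) \<noteq> None)"
        using y lt by (intro exI[of _ y]) force
      ultimately show "?L = Some y" by simp
    qed
    then show ?case by blast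
  qed
  then show ?thesis using that by blast
qed

section \<open>Binary expansions and dyadic intervals\<close>

text \<open>Most significant digit first, so that passing to a prefix is division by a power of two;
  digits of \<open>m\<close> beyond the lowest \<open>k\<close> are dropped.\<close>

fun bits :: "nat \<Rightarrow> nat \<Rightarrow> bool list" where
  "bits m 0 = []"
| "bits m (Suc k) = odd (m div 2 ^ k) # bits m k"

lemma length_bits [simp]: "length (bits m k) = k"
  by (induction k) auto

lemma recursive_string_code_bits [rec_intro]:
  assumes "recursive f" "recursive g"
  shows "recursive (\<lambda>n. string_code (bits (f n) (g n)))"
proof -
  \<comment> \<open>The code is built from the last digit backwards; \<open>Suc\<close> of a pair is
    how \<open>list_encode\<close> codes a cons.\<close>
  have "recursive (\<lambda>n. rec_nat 0 (\<lambda>j c. Suc (pe (of_bool (odd (f n div 2 ^ j))) c)) (g n))"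
    by (intro rec_intro assms recursive_comp[OF assms(1)])
  moreover have "rec_nat 0 (\<lambda>j c. Suc (pe (of_bool (odd (m div 2 ^ j))) c)) k = string_code (bits m k)" for m k
    by (induction k) (simp_all add: string_code_def)
  ultimately show ?thesis by simp
qed

fun prefix_value :: "(nat \<Rightarrow> bool) \<Rightarrow> nat \<Rightarrow> nat" where
  "prefix_value X 0 = 0"
| "prefix_value X (Suc k) = 2 * prefix_value X k + of_bool (X k)"

lemma prefix_value_div: "j \<le> k \<Longrightarrow> prefix_value X k div 2 ^ (k - j) = prefix_value X j"
proof (induction k)
  case (Suc k)
  show ?case
  proof (cases "j = Suc k")
    case False
    then have "2 ^ (Suc k - j) = (2::nat) * 2 ^ (k - j)"
      using Suc.prems by (simp add: Suc_diff_le)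
    then show ?thesis using Suc False by (simp add: div_mult2_eq)
  qed simp
qed simp

lemma bits_nth: "i < k \<Longrightarrow> bits m k ! i = odd (m div 2 ^ (k - Suc i))"
proof (induction k arbitrary: i)
  case (Suc k)
  then show ?case by (cases i) auto
qed simp

lemma bits_prefix_value: "bits (prefix_value X k) k = map X [0..<k]"
proof (rule nth_equalityI)
  fix i assume "i < length (bits (prefix_value X k) k)"
  then show "bits (prefix_value X k) k ! i = map X [0..<k] ! i"
    by (simp add: bits_nth prefix_value_div)
qed simp

lemma cylinder_iff_map: "X \<in> cylinder \<sigma> \<longleftrightarrow> map X [0..<length \<sigma>] = \<sigma>"
proof
  assume "X \<in> cylinder \<sigma>"
  then show "map X [0..<length \<sigma>] = \<sigma>" by (intro nth_equalityI) (auto simp: cylinder_def)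
next
  assume eq: "map X [0..<length \<sigma>] = \<sigma>"
  have "X i = \<sigma> ! i" if "i < length \<sigma>" for i
    using arg_cong[OF eq, of "\<lambda>xs. xs ! i"] that by simp
  then show "X \<in> cylinder \<sigma>" by (simp add: cylinder_def)
qed

lemma prefix_value_cong: "(\<And>i. i < k \<Longrightarrow> X i = Y i) \<Longrightarrow> prefix_value X k = prefix_value Y k"
  by (induction k) auto

lemma prefix_value_ex:
  assumes "r < 2 ^ k"
  shows "\<exists>X. prefix_value X k = r"
proof -
  define X where "X i = odd (r div 2 ^ (k - Suc i))" for i
  have "prefix_value X j = r div 2 ^ (k - j)" if "j \<le> k" for j
    using that
  proof (induction j)
    case 0
    then show ?case using assms by simp
  next
    case (Suc j)
    then have "k - j = Suc (k - Suc j)" by simp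
    then have "r div 2 ^ (k - j) = r div 2 ^ (k - Suc j) div 2"
      by (simp add: div_mult2_eq[symmetric] mult.commute)
    then show ?case using Suc by (simp add: X_def)
  qed
  from this[of k] show ?thesis by auto
qed

lemma cylinder_bits_iff:
  assumes "r < 2 ^ k"
  shows "X \<in> cylinder (bits r k) \<longleftrightarrow> prefix_value X k = r"
proof
  assume X: "X \<in> cylinder (bits r k)"
  obtain Y where Y: "prefix_value Y k = r" using prefix_value_ex[OF assms] ..
  have "map X [0..<k] = map Y [0..<k]"
    using X bits_prefix_value[of Y k] by (simp add: cylinder_iff_map Y)
  then have "prefix_value X k = prefix_value Y k" by (intro prefix_value_cong) simp
  then show "prefix_value X k = r" using Y by simp
next
  assume "prefix_value X k = r"
  then show "X \<in> cylinder (bits r k)"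
    using bits_prefix_value[of X k] by (simp add: cylinder_iff_map)
qed

text \<open>A nested sequence of strings, given by values \<open>r\<close> and lengths
  \<open>l\<close>, has a limit. Digit \<open>i\<close> can be read off at level \<open>i\<close>
  because \<open>i < l i\<close>, and all levels that are long enough agree on it.\<close>

lemma prefix_value_limit:
  fixes r l :: "nat \<Rightarrow> nat"
  assumes l: "\<And>x. x < l x" "\<And>x. l x \<le> l (Suc x)"
    and r: "\<And>x. r x = r (Suc x) div 2 ^ (l (Suc x) - l x)" "\<And>x. r x < 2 ^ l x"
  obtains X where "\<And>x. prefix_value X (l x) = r x"
proof -
  have mono: "l x \<le> l y" if "x \<le> y" for x y
    using that l(2) by (rule lift_Suc_mono_le[rotated])
  have nest: "r x div 2 ^ (l x - k) = r y div 2 ^ (l y - k)" if "x \<le> y" "k \<le> l x" for x y k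
    using that(1)
  proof (induction rule: dec_induct)
    case (step y)
    have "k \<le> l y" using mono[OF step(1)] that(2) by simp
    then have "l (Suc y) - k = (l (Suc y) - l y) + (l y - k)" using l(2)[of y] by simp
    then have "r (Suc y) div 2 ^ (l (Suc y) - k) = r y div 2 ^ (l y - k)"
      by (subst r(1)) (simp add: power_add div_mult2_eq)
    then show ?case using step by simp
  qed simp
  define X where "X i = odd (r i div 2 ^ (l i - Suc i))" for i
  have X: "X i = odd (r x div 2 ^ (l x - Suc i))" if "i < l x" for x i
    unfolding X_def using nest[of x i "Suc i"] nest[of i x "Suc i"] that l(1)[of i] by (cases "x \<le> i") auto
  have "prefix_value X k = r x div 2 ^ (l x - k)" if "k \<le> l x" for x k
    using that
  proof (induction k)
    case 0
    then show ?case using r(2) by simp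
  next
    case (Suc k)
    then have "l x - k = Suc (l x - Suc k)" by simp
    then have "r x div 2 ^ (l x - k) = r x div 2 ^ (l x - Suc k) div 2"
      by (simp add: div_mult2_eq[symmetric] mult.commute)
    then show ?case using Suc X[of k x] by simp
  qed
  from this[OF order.refl] show ?thesis by (intro that) simp
qed

section \<open>Real values of binary sequences\<close>

lemma summable_binary: "summable (\<lambda>n. of_bool (X n) * (1 / 2 :: real) ^ Suc n)"
proof (rule summable_comparison_test'[where N=0])
  show "summable (\<lambda>n. (1 / 2 :: real) ^ Suc n)" using power_half_series by (rule sums_summable)
qed (simp add: of_bool_def)

lemma sum_prefix_value: "(\<Sum>i<k. of_bool (X i) * (1 / 2 :: real) ^ Suc i) = prefix_value X k / 2 ^ k"
  by (induction k) (auto simp: field_simps)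

lemma binary_value_LIMSEQ: "(\<lambda>k. prefix_value X k / 2 ^ k) \<longlonglongrightarrow> binary_value X"
  using summable_LIMSEQ[OF summable_binary[of X]]
  unfolding sum_prefix_value binary_value_def .

lemma binary_value_nonneg: "0 \<le> binary_value X"
  unfolding binary_value_def by (rule suminf_nonneg[OF summable_binary]) auto

lemma binary_value_not: "binary_value (\<lambda>n. \<not> X n) = 1 - binary_value X"
proof -
  have "(\<lambda>n. (1 / 2) ^ Suc n - of_bool (X n) * (1 / 2 :: real) ^ Suc n) sums (1 - binary_value X)"
    unfolding binary_value_def
    by (intro sums_diff power_half_series summable_sums[OF summable_binary])
  moreover have "(\<lambda>n. (1 / 2) ^ Suc n - of_bool (X n) * (1 / 2 :: real) ^ Suc n)
      = (\<lambda>n. of_bool (\<not> X n) * (1 / 2) ^ Suc n)"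
    by (auto simp: of_bool_def)
  ultimately show ?thesis unfolding binary_value_def by (simp add: sums_iff)
qed

lemma binary_value_eq_0_imp:
  assumes "binary_value X = 0"
  shows "\<not> X n"
proof -
  have "\<forall>n. of_bool (X n) * (1 / 2 :: real) ^ Suc n = 0"
    by (rule suminf_eq_zero_iff[THEN iffD1, OF summable_binary])
      (use assms in \<open>simp_all add: binary_value_def\<close>)
  then have "of_bool (X n) * (1 / 2 :: real) ^ Suc n = 0" ..
  then show ?thesis by simp
qed

lemma binary_value_split:
  "binary_value X = prefix_value X l / 2 ^ l + binary_value (\<lambda>n. X (n + l)) / 2 ^ l"
proof -
  have "binary_value X = (\<Sum>n. of_bool (X (n + l)) * (1 / 2) ^ Suc (n + l)) + prefix_value X l / 2 ^ l"
    unfolding binary_value_def suminf_split_initial_segment[OF summable_binary, of _ l] sum_prefix_value ..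
  also have "(\<lambda>n. of_bool (X (n + l)) * (1 / 2 :: real) ^ Suc (n + l))
      = (\<lambda>n. (of_bool (X (n + l)) * (1 / 2) ^ Suc n) / 2 ^ l)"
    by (auto simp: power_add field_simps)
  also have "(\<Sum>n. (of_bool (X (n + l)) * (1 / 2 :: real) ^ Suc n) / 2 ^ l) = binary_value (\<lambda>n. X (n + l)) / 2 ^ l"
    unfolding binary_value_def by (rule suminf_divide[OF summable_binary])
  finally show ?thesis by simp
qed

text \<open>Scaled by \<open>2^l\<close>, the value of the tail is an integer in the unit interval.
  Value 0 forces only zeros, and value 1 forces only ones by complementation; this covers both
  expansions.\<close>

lemma dyadic_eventually_constant:
  assumes "binary_value X = real k / 2 ^ l"
  shows "\<exists>b. \<forall>n\<ge>l. X n = b"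
proof -
  let ?Y = "\<lambda>n. X (n + l)"
  have Y: "binary_value ?Y = real k - real (prefix_value X l)"
    using binary_value_split[of X l] assms by (simp add: field_simps)
  have le: "binary_value ?Y \<le> 1"
    using binary_value_nonneg[of "\<lambda>n. \<not> ?Y n"] binary_value_not[of ?Y] by simp
  have "binary_value ?Y = of_int (int k - int (prefix_value X l))" using Y by simp
  with le binary_value_nonneg[of ?Y] have "int k - int (prefix_value X l) \<in> {0, 1}"
    by simp linarith
  with Y consider "binary_value ?Y = 0" | "binary_value ?Y = 1" by force
  then have "\<exists>b. \<forall>n. ?Y n = b"
  proof cases
    case 1
    then show ?thesis using binary_value_eq_0_imp[of ?Y] by blast
  next
    case 2
    then show ?thesis using binary_value_eq_0_imp[of "\<lambda>n. \<not> ?Y n"] binary_value_not[of ?Y] by auto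
  qed
  then obtain b where b: "\<forall>n. ?Y n = b" ..
  have "X n = b" if "n \<ge> l" for n using b[rule_format, of "n - l"] that by simp
  then show ?thesis by blast
qed

section \<open>Coin-tossing measure and null classes\<close>

lemma emeasure_cantor_measure_fixed:
  assumes "finite J"
  shows "emeasure cantor_measure {X. \<forall>i\<in>J. X i = f i} = ennreal ((1 / 2) ^ card J)"
    and "{X. \<forall>i\<in>J. X i = f i} \<in> sets cantor_measure"
proof -
  let ?M = "\<lambda>_::nat. measure_pmf (bernoulli_pmf (1 / 2))"
  have pps: "product_prob_space ?M"
    by (intro product_prob_spaceI prob_space_measure_pmf)
  \<comment> \<open>Written as an embedded finite box, the set falls under the product
    formula.\<close>
  have eq: "{X. \<forall>i\<in>J. X i = f i} = prod_emb UNIV ?M J (Pi\<^sub>E J (\<lambda>i. {f i}))"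
  proof (rule set_eqI)
    fix X
    have "X \<in> prod_emb UNIV ?M J (Pi\<^sub>E J (\<lambda>i. {f i})) \<longleftrightarrow> restrict X J \<in> Pi\<^sub>E J (\<lambda>i. {f i})"
      unfolding prod_emb_def by (simp add: PiE_UNIV_domain del: restrict_PiE_iff)
    also have "\<dots> \<longleftrightarrow> (\<forall>i\<in>J. X i = f i)" unfolding restrict_PiE_iff by simp
    finally show "X \<in> {X. \<forall>i\<in>J. X i = f i} \<longleftrightarrow> X \<in> prod_emb UNIV ?M J (Pi\<^sub>E J (\<lambda>i. {f i}))" by simp
  qed
  have half: "emeasure (measure_pmf (bernoulli_pmf (1 / 2))) {b} = ennreal (1 / 2)" for b
    by (cases b) (simp_all add: emeasure_pmf_single)
  show "emeasure cantor_measure {X. \<forall>i\<in>J. X i = f i} = ennreal ((1 / 2) ^ card J)"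
  proof -
    have "emeasure cantor_measure {X. \<forall>i\<in>J. X i = f i} = (\<Prod>i\<in>J. emeasure (?M i) {f i})"
      unfolding cantor_measure_def eq by (rule product_prob_space.emeasure_PiM_emb[OF pps]) (use assms in auto)
    also have "... = ennreal (1 / 2) ^ card J" unfolding half by simp
    also have "... = ennreal ((1 / 2) ^ card J)" by (rule ennreal_power) simp
    finally show ?thesis .
  qed
  show "{X. \<forall>i\<in>J. X i = f i} \<in> sets cantor_measure"
    unfolding cantor_measure_def eq by (rule sets_PiM_I) (use assms in auto)
qed

text \<open>Cylinders have positive measure; hence the complement of a null class is dense.\<close>

lemma cylinder_not_subset_null:
  assumes "P \<in> null_sets cantor_measure"
  shows "\<exists>Y\<in>cylinder \<sigma>. Y \<notin> P"
proof (rule ccontr)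
  assume "\<not> ?thesis"
  then have "cylinder \<sigma> \<subseteq> P" by blast
  then have "emeasure cantor_measure (cylinder \<sigma>) = 0"
    using assms emeasure_mono[of "cylinder \<sigma>" P cantor_measure] by (auto simp: null_sets_def)
  moreover have "cylinder \<sigma> = {X. \<forall>i\<in>{..<length \<sigma>}. X i = \<sigma> ! i}" by (auto simp: cylinder_def)
  ultimately show False
    using emeasure_cantor_measure_fixed(1)[of "{..<length \<sigma>}" "\<lambda>i. \<sigma> ! i"] by simp
qed

lemma null_sets_eventually_constant: "{X. \<forall>i\<ge>N. X i = b} \<in> null_sets cantor_measure"
proof -
  let ?P = "{X. \<forall>i\<ge>N. X i = b}"
  let ?Q = "\<lambda>j. {X. \<forall>i\<in>{N..<N + j}. X i = b}"
  have "?P = (\<Inter>j. ?Q j)"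
  proof (intro set_eqI iffI)
    fix X assume X: "X \<in> (\<Inter>j. ?Q j)"
    show "X \<in> ?P"
      unfolding mem_Collect_eq
    proof (intro allI impI)
      fix i assume "i \<ge> N"
      moreover have "X \<in> ?Q (Suc i)" using X by blast
      ultimately show "X i = b" by auto
    qed
  qed auto
  then have sets: "?P \<in> sets cantor_measure"
    using emeasure_cantor_measure_fixed(2)[of _ "\<lambda>_. b"] by auto
  have le: "emeasure cantor_measure ?P \<le> ennreal ((1 / 2) ^ j)" for j
  proof -
    have "emeasure cantor_measure ?P \<le> emeasure cantor_measure (?Q j)"
      by (rule emeasure_mono) (use emeasure_cantor_measure_fixed(2) in auto)
    then show ?thesis using emeasure_cantor_measure_fixed(1)[of "{N..<N + j}" "\<lambda>_. b"] by simp
  qed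
  have "(\<lambda>j. ennreal ((1 / 2) ^ j)) \<longlonglongrightarrow> ennreal 0"
    by (intro tendsto_ennrealI LIMSEQ_realpow_zero) auto
  then have "emeasure cantor_measure ?P \<le> ennreal 0"
    by (rule LIMSEQ_le_const) (use le in auto)
  then show ?thesis using sets by (auto simp: null_sets_def)
qed

text \<open>The complement is enumerated by the strings of length above \<open>N\<close> whose last
  digit is not \<open>b\<close>. In \<open>Q\<close>, \<open>u\<close> packs value and length of
  such a string, and the parity of the value is the last digit.\<close>

lemma Pi01_class_eventually_constant: "Pi01_class {X. \<forall>i\<ge>N. X i = b}"
proof -
  define Q where "Q n u \<longleftrightarrow> n = string_code (bits (pfst u) (psnd u)) \<and> N < psnd u
    \<and> pfst u mod 2 = of_bool (\<not> b)" for n u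
  define W where "W = {n. \<exists>u. Q n u}"
  have "recursive_pred (\<lambda>m. Q (pfst m) (psnd m))"
    unfolding Q_def by (intro rec_intro)
  from partrec_least[OF this] have "re_set W"
    unfolding re_set_def W_def
    by (intro exI[of _ "\<lambda>n. if \<exists>y. Q n y then Some (LEAST y. Q n y) else None"]) (auto simp: dom_def)
  moreover have "{X. \<forall>i\<ge>N. X i = b} = - (\<Union>\<sigma>\<in>{\<sigma>. string_code \<sigma> \<in> W}. cylinder \<sigma>)"
  proof (intro set_eqI iffI)
    fix X assume X: "X \<in> {X. \<forall>i\<ge>N. X i = b}"
    show "X \<in> - (\<Union>\<sigma>\<in>{\<sigma>. string_code \<sigma> \<in> W}. cylinder \<sigma>)"
    proof
      assume "X \<in> (\<Union>\<sigma>\<in>{\<sigma>. string_code \<sigma> \<in> W}. cylinder \<sigma>)"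
      then obtain \<sigma> u where \<sigma>: "X \<in> cylinder \<sigma>" "Q (string_code \<sigma>) u"
        by (auto simp: W_def)
      have "inj (of_bool :: bool \<Rightarrow> nat)" by (auto simp: inj_def)
      then have inj: "inj string_code"
        unfolding string_code_def by (auto intro!: injI simp: list_encode_eq inj_map_eq_map)
      have eq: "\<sigma> = bits (pfst u) (psnd u)" and N: "N < psnd u" "pfst u mod 2 = of_bool (\<not> b)"
        using \<sigma>(2) injD[OF inj] by (auto simp: Q_def)
      have "X (psnd u - 1) = odd (pfst u)"
        using \<sigma>(1) N(1) unfolding eq cylinder_def by (auto simp: bits_nth)
      moreover have "X (psnd u - 1) = b" using X N(1) by auto
      ultimately show False using N(2) by (cases b) (auto simp: odd_iff_mod_2_eq_one)
    qed
  next
    fix X assume X: "X \<in> - (\<Union>\<sigma>\<in>{\<sigma>. string_code \<sigma> \<in> W}. cylinder \<sigma>)"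
    show "X \<in> {X. \<forall>i\<ge>N. X i = b}"
    proof (rule ccontr)
      assume "X \<notin> {X. \<forall>i\<ge>N. X i = b}"
      then obtain i where i: "i \<ge> N" "X i \<noteq> b" by blast
      let ?\<sigma> = "bits (prefix_value X (Suc i)) (Suc i)"
      have "Q (string_code ?\<sigma>) (pe (prefix_value X (Suc i)) (Suc i))"
        using i by (auto simp: Q_def mod2_eq_if)
      then have "string_code ?\<sigma> \<in> W" by (auto simp: W_def)
      moreover have "X \<in> cylinder ?\<sigma>"
        unfolding cylinder_iff_map length_bits by (rule bits_prefix_value[symmetric])
      ultimately show False using X by blast
    qed
  qed
  ultimately show ?thesis unfolding Pi01_class_def by blast
qed

lemma not_Kurtz_random_real_dyadic: "\<not> Kurtz_random_real (real k / 2 ^ l)"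
proof
  assume "Kurtz_random_real (real k / 2 ^ l)"
  then obtain X where X: "binary_value X = real k / 2 ^ l" "Kurtz_random X"
    by (auto simp: Kurtz_random_real_def)
  obtain b where "\<forall>n\<ge>l. X n = b" using dyadic_eventually_constant[OF X(1)] ..
  then show False
    using X(2) null_sets_eventually_constant[of l b] Pi01_class_eventually_constant[of l b]
    unfolding Kurtz_random_def by blast
qed

section \<open>From dyadic approximations to a numbering by weights\<close>

lemma binlen_eq:
  assumes "2 ^ k \<le> x" "x < 2 ^ Suc k"
  shows "binlen x = Suc k"
proof -
  have "\<lceil>log 2 (real x + 1)\<rceil> = int (Suc k)"
  proof (rule ceiling_unique)
    have "2 ^ k < x + 1" using assms(1) by simp
    then have "real (2 ^ k) < real (x + 1)" by (simp only: of_nat_less_iff)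
    then show "real_of_int (int (Suc k)) - 1 < log 2 (real x + 1)"
      by (simp add: less_log_iff powr_realpow)
    have "x + 1 \<le> 2 ^ Suc k" using assms(2) by simp
    then have "real (x + 1) \<le> real (2 ^ Suc k)" by (simp only: of_nat_le_iff)
    then show "log 2 (real x + 1) \<le> real_of_int (int (Suc k))"
      by (subst log_le_iff) (simp_all add: powr_realpow powr_add mult.commute)
  qed
  then show ?thesis by (simp add: binlen_def)
qed

lemma left_re_numbering_dyadic_approx:
  fixes num :: "nat \<Rightarrow> nat \<Rightarrow> nat"
  assumes rec: "recursive (\<lambda>m. num (pfst m) (psnd m))"
    and num_0: "\<And>e. num e 0 = 0"
    and mono: "\<And>e s. 2 * num e s \<le> num e (Suc s)"
    and bound: "\<And>e s. num e s \<le> 2 ^ (s - 1)"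
    and lim: "\<And>e. (\<lambda>s. num e s / 2 ^ s) \<longlonglongrightarrow> \<beta> e"
  shows "left_re_numbering \<beta>"
proof -
  \<comment> \<open>There are \<open>2\<^sup>k\<close> numbers of length \<open>k + 1\<close>, each of weight \<open>2\<^sup>-\<^sup>k\<^sup>-\<^sup>1\<close>; take as many of them as
    the approximation grows by between stages \<open>k\<close> and \<open>k + 1\<close>.\<close>
  define Q where "Q e x \<longleftrightarrow> (\<exists>k<x. 2 ^ k \<le> x \<and> x < 2 ^ Suc k \<and> x - 2 ^ k < num e (Suc k) - 2 * num e k)"
    for e x
  \<comment> \<open>The dummy \<open>y\<close> lets \<open>partrec_least\<close> turn a decidable
    set into the domain of a partial recursive function.\<close>
  define P where "P n (y::nat) \<longleftrightarrow> Q (pfst n) (psnd n)" for n y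
  have "recursive_pred (\<lambda>m. P (pfst m) (psnd m))"
    unfolding P_def Q_def by (intro rec_intro recursive_comp2[OF rec])
  from partrec_least[OF this]
  have part: "partrec (\<lambda>n. if \<exists>y. P n y then Some (LEAST y. P n y) else None)" (is "partrec ?\<phi>") .
  have dom: "{x. ?\<phi> (pe e x) \<noteq> None} = {x. Q e x}" for e by (auto simp: P_def)
  have "((\<lambda>x. (1 / 2) ^ binlen x) has_sum \<beta> e) {x. Q e x} \<and> \<beta> e \<le> 1" for e
  proof
    define f where "f x = of_bool (Q e x) * (1 / 2 :: real) ^ binlen x" for x
    \<comment> \<open>The blocks from \<open>2^k\<close> to \<open>2^(k+1)\<close> are disjoint, so
      the \<open>k\<close> hidden in \<open>Q\<close> is unique.\<close>
    have Q_iff: "Q e x \<longleftrightarrow> x - 2 ^ k < num e (Suc k) - 2 * num e k" if "2 ^ k \<le> x" "x < 2 ^ Suc k" for x k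
    proof -
      have "j = k" if j: "2 ^ j \<le> x" "x < 2 ^ Suc j" for j
      proof -
        have "(2::nat) ^ j < 2 ^ Suc k" "(2::nat) ^ k < 2 ^ Suc j"
          using j \<open>2 ^ k \<le> x\<close> \<open>x < 2 ^ Suc k\<close> by linarith+
        then have "j < Suc k" "k < Suc j" by (metis one_less_numeral_iff power_less_imp_less_exp semiring_norm(76))+
        then show ?thesis by simp
      qed
      moreover have "k < x" using that(1) less_exp[of k] by linarith
      ultimately show ?thesis unfolding Q_def using that by blast
    qed
    have part_sum: "(\<Sum>x<2 ^ N. f x) = num e N / 2 ^ N" for N
    proof (induction N)
      case 0
      \<comment> \<open>The number 0 has length 0 and weight 1; leaving it out matches
        \<open>num e 0 = 0\<close>.\<close>
      have "\<not> Q e 0" by (simp add: Q_def)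
      then show ?case by (simp add: f_def num_0)
    next
      case (Suc N)
      let ?a = "num e (Suc N) - 2 * num e N"
      have a: "?a \<le> 2 ^ N" using bound[of e "Suc N"] by simp
      have "(\<Sum>x\<in>{2 ^ N..<2 ^ Suc N}. f x) = (\<Sum>x\<in>{2 ^ N..<2 ^ N + ?a}. (1 / 2) ^ Suc N)"
      proof (rule sum.mono_neutral_cong_right)
        show "{2 ^ N..<2 ^ N + ?a} \<subseteq> {2 ^ N..<2 ^ Suc N}" using a by auto
        show "\<forall>x\<in>{2 ^ N..<2 ^ Suc N} - {2 ^ N..<2 ^ N + ?a}. f x = 0"
          using Q_iff[of N] by (auto simp: f_def)
        show "f x = (1 / 2) ^ Suc N" if "x \<in> {2 ^ N..<2 ^ N + ?a}" for x
        proof -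
          have x: "2 ^ N \<le> x" "x < 2 ^ Suc N" "x - 2 ^ N < ?a" using that a by auto
          then show ?thesis using Q_iff[OF x(1,2)] binlen_eq[OF x(1,2)] by (simp add: f_def)
        qed
      qed simp
      also have "\<dots> = (real (num e (Suc N)) - 2 * real (num e N)) / 2 ^ Suc N"
        using mono[of e N] by (simp add: of_nat_diff power_one_over field_simps)
      finally have "(\<Sum>x\<in>{2 ^ N..<2 ^ Suc N}. f x) = (real (num e (Suc N)) - 2 * real (num e N)) / 2 ^ Suc N" .
      moreover have "(\<Sum>x<2 ^ Suc N. f x) = (\<Sum>x<2 ^ N. f x) + (\<Sum>x\<in>{2 ^ N..<2 ^ Suc N}. f x)"
        unfolding lessThan_atLeast0 by (rule sum.atLeastLessThan_concat[symmetric]) auto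
      ultimately show ?case using Suc by (simp add: field_simps)
    qed
    have f0: "0 \<le> f x" for x by (simp add: f_def)
    have "num e s / 2 ^ s \<le> num e (Suc s) / (2 ^ Suc s :: real)" for s
      using mono[of e s] by (simp add: field_simps)
    then have inc: "incseq (\<lambda>s. num e s / (2 ^ s :: real))" by (rule incseq_SucI)
    have "(\<Sum>x<n. f x) \<le> \<beta> e" for n
    proof -
      have "(\<Sum>x<n. f x) \<le> (\<Sum>x<2 ^ n. f x)"
        by (rule sum_mono2) (use f0 less_exp[of n] in auto)
      then show ?thesis unfolding part_sum using incseq_le[OF inc lim, of n] by simp
    qed
    then have sm: "summable f" by (intro summableI_nonneg_bounded f0)
    \<comment> \<open>The partial sums are known explicitly only at powers of two; this subsequence
      identifies the sum.\<close>
    have "strict_mono (\<lambda>N. 2 ^ N :: nat)" by (rule strict_monoI) simp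
    from LIMSEQ_subseq_LIMSEQ[OF summable_LIMSEQ[OF sm] this]
    have "(\<lambda>N. num e N / 2 ^ N) \<longlonglongrightarrow> suminf f" by (simp add: o_def part_sum)
    with lim[of e] have "suminf f = \<beta> e" using LIMSEQ_unique by blast
    with sm have "f sums \<beta> e" by (simp add: sums_iff)
    then have "(f has_sum \<beta> e) UNIV" by (rule sums_nonneg_imp_has_sum) (rule f0)
    then show "((\<lambda>x. (1 / 2) ^ binlen x) has_sum \<beta> e) {x. Q e x}"
      by (rule has_sum_cong_neutral[THEN iffD1, rotated -1]) (auto simp: f_def)
    have "num e s / 2 ^ s \<le> (1 :: real)" for s
    proof -
      have "num e s \<le> 2 ^ s" using bound[of e s] power_increasing[of "s - 1" s "2::nat"] by linarith
      then have "real (num e s) \<le> 2 ^ s" by (metis of_nat_le_iff of_nat_numeral of_nat_power)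
      then show ?thesis by (simp add: field_simps)
    qed
    then show "\<beta> e \<le> 1" using LIMSEQ_le_const2[OF lim] by blast
  qed
  then show ?thesis unfolding left_re_numbering_def using part dom by (intro exI[of _ ?\<phi>]) simp
qed

section \<open>The construction\<close>

text \<open>The string of length \<open>l\<close> with binary value \<open>r\<close> is coded as \<open>pe r l\<close> and identified with the
  dyadic interval from \<open>r / 2\<^sup>l\<close> to \<open>(r + 1) / 2\<^sup>l\<close>.\<close>

definition left :: "nat \<Rightarrow> real" where
  "left p = real (pfst p) / 2 ^ psnd p"

definition width :: "nat \<Rightarrow> real" where
  "width p = 1 / 2 ^ psnd p"

text \<open>The prefix relation on coded strings.\<close>

definition refines :: "nat \<Rightarrow> nat \<Rightarrow> bool" where
  "refines p q \<longleftrightarrow> psnd p \<le> psnd q \<and> pfst q div 2 ^ (psnd q - psnd p) = pfst p"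

text \<open>Clearing the whole interval of \<open>p\<close>, and not just its left end, makes the
  relation survive arbitrary extensions of both strings.\<close>

definition passed :: "nat \<Rightarrow> nat \<Rightarrow> bool" where
  "passed p q \<longleftrightarrow> left p + width p \<le> left q"

lemma width_pos: "0 < width p"
  by (simp add: width_def)

lemma refines_refl [simp]: "refines p p"
  by (simp add: refines_def)

lemma refines_trans [trans]:
  assumes "refines p q" "refines q r"
  shows "refines p r"
proof -
  have "psnd r - psnd p = (psnd r - psnd q) + (psnd q - psnd p)"
    using assms by (simp add: refines_def)
  then have "pfst r div 2 ^ (psnd r - psnd p) = pfst r div 2 ^ (psnd r - psnd q) div 2 ^ (psnd q - psnd p)"
    by (simp only: power_add div_mult2_eq)
  then show ?thesis using assms by (simp add: refines_def)
qed

lemma refines_interval: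
  assumes "refines p q"
  shows "left p \<le> left q" "left q + width q \<le> left p + width p"
proof -
  define d where "d = psnd q - psnd p"
  have d: "psnd q = psnd p + d" and r: "pfst q div 2 ^ d = pfst p"
    using assms by (simp_all add: refines_def d_def)
  have "pfst p * 2 ^ d \<le> pfst q" using div_times_less_eq_dividend[of "pfst q" "2 ^ d"] by (simp add: r)
  then have "real (pfst p * 2 ^ d) \<le> real (pfst q)" by (simp only: of_nat_le_iff)
  then show "left p \<le> left q" by (simp add: left_def d power_add field_simps)
  have "pfst q < 2 ^ d + pfst q div 2 ^ d * 2 ^ d" by (rule dividend_less_div_times) simp
  then have "pfst q + 1 \<le> (pfst p + 1) * 2 ^ d" by (simp add: r)
  then have "real (pfst q + 1) \<le> real ((pfst p + 1) * 2 ^ d)" by (simp only: of_nat_le_iff)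
  then have "real (pfst q + 1) / 2 ^ d / 2 ^ psnd p \<le> real (pfst p + 1) / 2 ^ psnd p"
    by (intro divide_right_mono) (simp_all add: field_simps)
  then show "left q + width q \<le> left p + width p"
    by (simp add: left_def width_def d power_add add_divide_distrib mult.commute)
qed

lemma refines_left_le: "refines p q \<Longrightarrow> left q \<le> left p + width p"
  using refines_interval(2)[of p q] width_pos[of q] by linarith

lemma refines_valid:
  assumes "refines p q" "pfst p < 2 ^ psnd p"
  shows "pfst q < 2 ^ psnd q"
proof -
  have "left q + width q \<le> left p + width p" by (rule refines_interval) fact
  also have "\<dots> \<le> 1"
  proof -
    have "real (pfst p + 1) \<le> real (2 ^ psnd p)" using assms(2) by (simp only: of_nat_le_iff)
    then show ?thesis by (simp add: left_def width_def field_simps)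
  qed
  finally have "real (pfst q + 1) \<le> real (2 ^ psnd q)" by (simp add: left_def width_def field_simps)
  then show ?thesis by (simp only: of_nat_le_iff)
qed

text \<open>This is why higher levels may be rebuilt freely once a lower level has moved to the
  right.\<close>

lemma passed_refines:
  assumes "passed p q" "refines p p'" "refines q q'"
  shows "passed p' q'"
  using assms(1) refines_interval[OF assms(2)] refines_interval[OF assms(3)]
  unfolding passed_def by linarith

section \<open>Extending strings\<close>

text \<open>The block \<open>1^n 0\<close> has value \<open>2^(n+1) - 2\<close>, which is absorbed
  into the product with \<open>pfst p + 1\<close>.\<close>

definition ones_zero :: "nat \<Rightarrow> nat \<Rightarrow> nat" where
  "ones_zero n p = pe ((pfst p + 1) * 2 ^ Suc n - 2) (psnd p + Suc n)"

definition append0 :: "nat \<Rightarrow> nat" where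
  "append0 p = pe (2 * pfst p) (Suc (psnd p))"

text \<open>Appends \<open>1\<tau>\<close>, where \<tau> has value \<open>pfst u\<close> and length
  \<open>pfst (psnd u)\<close>; the other components of \<open>u\<close> hold the certificate
  checked by \<open>witness\<close>.\<close>

definition append1 :: "nat \<Rightarrow> nat \<Rightarrow> nat" where
  "append1 u p = pe ((2 * pfst p + 1) * 2 ^ pfst (psnd u) + pfst u) (Suc (psnd p) + pfst (psnd u))"

lemma refines_ones_zero: "refines p (ones_zero n p)"
proof -
  have "(pfst p + 1) * 2 ^ Suc n - 2 = pfst p * 2 ^ Suc n + (2 ^ Suc n - 2)"
    by (simp add: algebra_simps)
  moreover have "(pfst p * 2 ^ Suc n + (2 ^ Suc n - 2)) div 2 ^ Suc n = pfst p"
    by (subst div_mult_self3) (simp_all del: power_Suc)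
  ultimately show ?thesis by (simp add: refines_def ones_zero_def del: power_Suc)
qed

lemma refines_append0: "refines p (append0 p)"
  by (simp add: refines_def append0_def)

lemma append1_div:
  assumes "pfst u < 2 ^ pfst (psnd u)"
  shows "pfst (append1 u p) div 2 ^ pfst (psnd u) = 2 * pfst p + 1"
proof -
  have "((2 * pfst p + 1) * 2 ^ pfst (psnd u) + pfst u) div 2 ^ pfst (psnd u) = 2 * pfst p + 1"
    by (subst div_mult_self3) (use assms in simp_all)
  then show ?thesis by (simp add: append1_def)
qed

lemma refines_append1:
  assumes "pfst u < 2 ^ pfst (psnd u)"
  shows "refines p (append1 u p)" "passed (append0 p) (append1 u p)"
proof -
  let ?q = "pe (2 * pfst p + 1) (Suc (psnd p))"
  have "refines p ?q" by (simp add: refines_def)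
  moreover have q: "refines ?q (append1 u p)"
    using append1_div[OF assms, of p] by (simp add: refines_def append1_def)
  ultimately show "refines p (append1 u p)" by (rule refines_trans)
  have "passed (append0 p) ?q"
    by (simp add: passed_def left_def width_def append0_def field_simps)
  then show "passed (append0 p) (append1 u p)" by (rule passed_refines[OF _ refines_refl q])
qed

lemma left_ones_zero: "left (ones_zero n p) = left p + width p * (1 - (1 / 2) ^ n)"
proof -
  have "2 \<le> (pfst p + 1) * 2 ^ Suc n"
    using mult_le_mono[of 1 "pfst p + 1" 2 "2 ^ Suc n"] by simp
  then show ?thesis
    by (simp add: left_def width_def ones_zero_def of_nat_diff power_add power_one_over field_simps)
qed

text \<open>Below \<open>p\<close>, the interval of \<open>1^n 0\<close> ends where that of
  \<open>1^(n+1)\<close> begins, so a growing guess moves to the right.\<close>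

lemma passed_ones_zero:
  assumes "n < n'"
  shows "passed (ones_zero n p) (ones_zero n' p)"
proof -
  have w: "width (ones_zero n p) = width p * (1 / 2) ^ Suc n"
    by (simp add: width_def ones_zero_def power_add power_one_over)
  have "(1 / 2 :: real) ^ n' \<le> (1 / 2) ^ Suc n" by (rule power_decreasing) (use assms in auto)
  then have "1 - (1 / 2 :: real) ^ n + (1 / 2) ^ Suc n \<le> 1 - (1 / 2) ^ n'" by simp
  then have "width p * (1 - (1 / 2 :: real) ^ n + (1 / 2) ^ Suc n) \<le> width p * (1 - (1 / 2) ^ n')"
    using width_pos[of p] by (intro mult_left_mono) auto
  then show ?thesis unfolding passed_def left_ones_zero w by (simp add: algebra_simps)
qed

section \<open>Bounded search for a string in an open set\<close>

text \<open>The alternative \<open>u = s\<close> makes a search total, and the result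
  \<open>s\<close> signals failure below \<open>s\<close>. Both \<open>search\<close> and
  \<open>guess\<close> have this form.\<close>

lemma Least_bounded_cases:
  fixes P :: "nat \<Rightarrow> bool"
  shows "(LEAST u. u = s \<or> P u) \<le> s"
    and "(LEAST u. u = s \<or> P u) < s \<Longrightarrow> P (LEAST u. u = s \<or> P u)"
    and "u < s \<Longrightarrow> P u \<Longrightarrow> (LEAST u. u = s \<or> P u) = (LEAST u. P u)"
proof -
  have L: "(LEAST u. u = s \<or> P u) = s \<or> P (LEAST u. u = s \<or> P u)"
    by (rule LeastI[of _ s]) simp
  show "(LEAST u. u = s \<or> P u) \<le> s" by (rule Least_le) simp
  show "(LEAST u. u = s \<or> P u) < s \<Longrightarrow> P (LEAST u. u = s \<or> P u)"
    using L by auto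
  assume u: "u < s" "P u"
  show "(LEAST u. u = s \<or> P u) = (LEAST u. P u)"
  proof (rule Least_equality)
    show "(LEAST u. P u) = s \<or> P (LEAST u. P u)" using LeastI[of P u] u by blast
    show "(LEAST u. P u) \<le> y" if "y = s \<or> P y" for y
      using that Least_le[of P u] Least_le[of P y] u by auto
  qed
qed

text \<open>Here \<open>u\<close> packs \<open>(m, k, t, j, y)\<close>: \<open>\<tau>\<close> has length \<open>k\<close> and value \<open>m\<close>, and at stage \<open>t\<close> program
  \<open>x\<close> is seen to accept, with output \<open>y\<close>, the prefix of length \<open>j\<close> of \<open>p1\<tau>\<close>.\<close>

definition witness :: "nat \<Rightarrow> nat \<Rightarrow> nat \<Rightarrow> bool" where
  "witness x p u \<longleftrightarrow>
    (let q = append1 u p; v = psnd (psnd u); t = pfst v; j = pfst (psnd v); y = psnd (psnd v)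
     in pfst u < 2 ^ pfst (psnd u) \<and> j \<le> psnd q
       \<and> pe x (pe (string_code (bits (pfst q div 2 ^ (psnd q - j)) j)) y) \<in> set_decode (eval_stage t))"

definition search :: "nat \<Rightarrow> nat \<Rightarrow> nat \<Rightarrow> nat" where
  "search x p s = (LEAST u. u = s \<or> witness x p u)"

text \<open>What is avoided is the closed class, by entering its enumerated open complement.\<close>

definition avoid :: "nat \<Rightarrow> nat \<Rightarrow> nat \<Rightarrow> nat" where
  "avoid x p s = (if search x p s < s then append1 (search x p s) p else append0 p)"

definition avoid_limit :: "nat \<Rightarrow> nat \<Rightarrow> nat" where
  "avoid_limit x p = (if \<exists>u. witness x p u then append1 (LEAST u. witness x p u) p else append0 p)"

lemma witness_less: "witness x p u \<Longrightarrow> pfst u < 2 ^ pfst (psnd u)"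
  by (simp add: witness_def Let_def)

lemma search_less_imp_witness: "search x p s < s \<Longrightarrow> witness x p (search x p s)"
  unfolding search_def by (rule Least_bounded_cases(2))

lemma refines_avoid: "refines p (avoid x p s)"
  using refines_append0 refines_append1(1) witness_less search_less_imp_witness
  unfolding avoid_def by metis

text \<open>A least witness, once below the bound, is final. The only possible change is from
  \<open>p0\<close> to some \<open>p1\<tau>\<close>, which lies to the right.\<close>

lemma avoid_mono:
  assumes "s \<le> s'"
  shows "avoid x p s = avoid x p s' \<or> passed (avoid x p s) (avoid x p s')"
proof (cases "search x p s < s")
  case True
  from search_less_imp_witness[OF this] have w: "witness x p (search x p s)" .
  have "search x p s' = search x p s"
    using Least_bounded_cases(3)[of "search x p s" s "witness x p"]
      Least_bounded_cases(3)[of "search x p s" s' "witness x p"] w True assms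
    by (simp add: search_def)
  then show ?thesis using True assms by (simp add: avoid_def)
next
  case False
  then show ?thesis
    using refines_append1(2) witness_less search_less_imp_witness
    unfolding avoid_def by metis
qed

lemma eventually_avoid: "eventually (\<lambda>s. avoid x p s = avoid_limit x p) sequentially"
proof (cases "\<exists>u. witness x p u")
  case True
  then obtain u where u: "witness x p u" ..
  have "avoid x p s = avoid_limit x p" if "s > u" for s
  proof -
    have eq: "search x p s = (LEAST u. witness x p u)"
      unfolding search_def by (rule Least_bounded_cases(3)) (use that u in auto)
    also have "\<dots> \<le> u" using u by (rule Least_le)
    finally have "search x p s < s" using that by simp
    then show ?thesis using True eq by (simp add: avoid_def avoid_limit_def)
  qed
  then show ?thesis unfolding eventually_sequentially by (intro exI[of _ "Suc u"]) auto
next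
  case False
  then have "avoid x p s = avoid_limit x p" for s
    using search_less_imp_witness by (auto simp: avoid_def avoid_limit_def)
  then show ?thesis by simp
qed

lemma psnd_avoid: "psnd p < psnd (avoid x p s)"
  by (simp add: avoid_def append0_def append1_def)

lemma recursive_append0 [rec_intro]: "recursive p \<Longrightarrow> recursive (\<lambda>n. append0 (p n))"
  unfolding append0_def by (intro rec_intro)

lemma recursive_append1 [rec_intro]:
  "recursive u \<Longrightarrow> recursive p \<Longrightarrow> recursive (\<lambda>n. append1 (u n) (p n))"
  unfolding append1_def by (intro rec_intro)

lemma recursive_ones_zero [rec_intro]:
  "recursive k \<Longrightarrow> recursive p \<Longrightarrow> recursive (\<lambda>n. ones_zero (k n) (p n))"
  unfolding ones_zero_def by (intro rec_intro)

lemma recursive_pred_witness [rec_intro]: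
  "recursive x \<Longrightarrow> recursive p \<Longrightarrow> recursive u \<Longrightarrow> recursive_pred (\<lambda>n. witness (x n) (p n) (u n))"
  unfolding witness_def Let_def by (intro rec_intro)

lemma recursive_search [rec_intro]:
  assumes "recursive x" "recursive p" "recursive s"
  shows "recursive (\<lambda>n. search (x n) (p n) (s n))"
  unfolding search_def
  by (intro rec_intro recursive_comp[OF assms(1)] recursive_comp[OF assms(2)] recursive_comp[OF assms(3)]) auto

lemma recursive_avoid [rec_intro]:
  assumes "recursive x" "recursive p" "recursive s"
  shows "recursive (\<lambda>n. avoid (x n) (p n) (s n))"
  unfolding avoid_def by (intro rec_intro assms)

lemma nat_incseq_bounded_eventually_const:
  fixes f :: "nat \<Rightarrow> nat"
  assumes "incseq f" "\<And>s. f s \<le> B"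
  shows "\<exists>n. eventually (\<lambda>s. f s = n) sequentially"
proof -
  have fin: "finite (range f)" by (rule finite_subset[of _ "{..B}"]) (use assms(2) in auto)
  then have "Max (range f) \<in> range f" by (intro Max_in) auto
  then obtain s where s: "f s = Max (range f)" by auto
  have "f t = f s" if "t \<ge> s" for t
    using incseqD[OF assms(1) that] Max_ge[OF fin, of "f t"] s by simp
  then show ?thesis unfolding eventually_sequentially by blast
qed

text \<open>By density, some \<open>Y\<close> through \<open>p1\<close> lies in an enumerated
  cylinder. Following \<open>Y\<close> for as many further digits as the enumerated string is long
  makes that string a prefix of \<open>p1\<tau>\<close>.\<close>

lemma null_class_witness:
  assumes c: "\<And>n y. f n = Some y \<longleftrightarrow> evals c n y"
    and P: "P = - (\<Union>\<sigma>\<in>{\<sigma>. string_code \<sigma> \<in> dom f}. cylinder \<sigma>)" "P \<in> null_sets cantor_measure"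
    and p: "pfst p < 2 ^ psnd p"
  shows "\<exists>u. witness c p u"
proof -
  let ?r = "2 * pfst p + 1" and ?l = "Suc (psnd p)"
  obtain Y where Y: "Y \<in> cylinder (bits ?r ?l)" "Y \<notin> P"
    using cylinder_not_subset_null[OF P(2)] by blast
  then obtain \<sigma> y where \<sigma>: "Y \<in> cylinder \<sigma>" "f (string_code \<sigma>) = Some y"
    using P(1) by auto
  have Yr: "prefix_value Y ?l = ?r" using Y(1) p by (subst (asm) cylinder_bits_iff) auto
  define j where "j = length \<sigma>"
  obtain t where t: "pe c (pe (string_code \<sigma>) y) \<in> set_decode (eval_stage t)"
    using \<sigma>(2) c by (auto simp: evals_def)
  define m where "m = prefix_value Y (?l + j)"
  have "m div 2 ^ j = ?r" using prefix_value_div[of ?l "?l + j" Y] Yr by (simp add: m_def)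
  then have m: "?r * 2 ^ j + m mod 2 ^ j = m" by (metis div_mult_mod_eq)
  \<comment> \<open>Here \<tau> consists of the last \<open>j\<close> digits of \<open>m\<close>;
    the first \<open>j\<close> is its length, the second the length of the accepted prefix.\<close>
  define u where "u = pe (m mod 2 ^ j) (pe j (pe t (pe j y)))"
  have app: "append1 u p = pe m (?l + j)" using m by (simp add: append1_def u_def)
  have "m div 2 ^ (?l + j - j) = prefix_value Y j"
    unfolding m_def by (rule prefix_value_div) simp
  moreover have "bits (prefix_value Y j) j = \<sigma>"
    using \<sigma>(1) by (simp add: bits_prefix_value cylinder_iff_map j_def)
  ultimately have "witness c p u"
    using t unfolding witness_def Let_def app by (simp add: u_def)
  then show ?thesis ..
qed

section \<open>Stages of the construction for a fixed matrix\<close>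

locale Pi03_matrix =
  fixes R :: "nat set"
  assumes recursive_R: "recursive_set R"
begin

text \<open>A value below the cap \<open>s\<close> is the least candidate not refuted by any
  \<open>z < s\<close>.\<close>

definition guess :: "nat \<Rightarrow> nat \<Rightarrow> nat \<Rightarrow> nat" where
  "guess e x s = (LEAST y. y = s \<or> (\<forall>z<s. pe e (pe x (pe y z)) \<in> R))"

text \<open>The initial digit \<open>0\<close> keeps all values below \<open>1 / 2\<close>, which is the total weight available at each length
  in \<open>left_re_numbering_dyadic_approx\<close>.\<close>

definition state :: "nat \<Rightarrow> nat \<Rightarrow> nat \<Rightarrow> nat" where
  "state e s x = rec_nat (pe 0 1) (\<lambda>x p. avoid x (ones_zero (guess e x s) p) s) x"

text \<open>The string at stage \<open>s\<close> is longer than \<open>s\<close>, so its value is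
  rounded down to a multiple of \<open>2^-s\<close>.\<close>

definition approx :: "nat \<Rightarrow> nat \<Rightarrow> nat" where
  "approx e s = 2 ^ s * pfst (state e s s) div 2 ^ psnd (state e s s)"

definition limit_real :: "nat \<Rightarrow> real" where
  "limit_real e = lim (\<lambda>s. left (state e s s))"

lemma recursive_pred_R [rec_intro]: "recursive f \<Longrightarrow> recursive_pred (\<lambda>n. f n \<in> R)"
  using recursive_comp[of "\<lambda>n. if n \<in> R then 1 else 0" f] recursive_R
  by (simp add: recursive_pred_def recursive_set_def of_bool_def)

lemma recursive_guess [rec_intro]:
  assumes "recursive e" "recursive x" "recursive s"
  shows "recursive (\<lambda>n. guess (e n) (x n) (s n))"
  unfolding guess_def
  by (intro rec_intro recursive_comp[OF assms(1)] recursive_comp[OF assms(2)] recursive_comp[OF assms(3)]) auto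

lemma recursive_state [rec_intro]:
  assumes "recursive e" "recursive s" "recursive x"
  shows "recursive (\<lambda>n. state (e n) (s n) (x n))"
  unfolding state_def
  by (intro rec_intro recursive_comp[OF assms(1)] recursive_comp[OF assms(2)] assms(3))

lemma recursive_approx: "recursive (\<lambda>m. approx (pfst m) (psnd m))"
  unfolding approx_def by (intro rec_intro)

lemma guess_less_imp:
  assumes "guess e x s < s"
  shows "\<forall>z<s. pe e (pe x (pe (guess e x s) z)) \<in> R"
  using assms unfolding guess_def by (rule Least_bounded_cases(2))

text \<open>A candidate unrefuted at \<open>s'\<close> is unrefuted at \<open>s\<close>; if only the
  cap is left at \<open>s'\<close>, it dominates the earlier cap.\<close>

lemma guess_mono:
  assumes "s \<le> s'"
  shows "guess e x s \<le> guess e x s'"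
proof (cases "guess e x s' < s'")
  case True
  from guess_less_imp[OF this] show ?thesis unfolding guess_def[of e x s] using assms by (intro Least_le) auto
next
  case False
  have "guess e x s \<le> s" unfolding guess_def by (rule Least_bounded_cases(1))
  then show ?thesis using False assms by simp
qed

lemma guess_eventually_const_iff:
  "(\<exists>n. eventually (\<lambda>s. guess e x s = n) sequentially) \<longleftrightarrow> (\<exists>y. \<forall>z. pe e (pe x (pe y z)) \<in> R)"
proof
  assume "\<exists>n. eventually (\<lambda>s. guess e x s = n) sequentially"
  then obtain n s0 where n: "\<And>s. s \<ge> s0 \<Longrightarrow> guess e x s = n"
    unfolding eventually_sequentially by blast
  have "pe e (pe x (pe n z)) \<in> R" for z
  proof -
    \<comment> \<open>Beyond \<open>n\<close> the guess is not the cap, and beyond \<open>z\<close>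
      it has passed the test at \<open>z\<close>.\<close>
    let ?s = "Suc (max s0 (max n z))"
    have "guess e x ?s = n" by (rule n) simp
    then show ?thesis using guess_less_imp[of e x ?s] by simp
  qed
  then show "\<exists>y. \<forall>z. pe e (pe x (pe y z)) \<in> R" by blast
next
  assume "\<exists>y. \<forall>z. pe e (pe x (pe y z)) \<in> R"
  then obtain y where "\<forall>z. pe e (pe x (pe y z)) \<in> R" ..
  then have "guess e x s \<le> y" for s unfolding guess_def by (intro Least_le) auto
  then show "\<exists>n. eventually (\<lambda>s. guess e x s = n) sequentially"
    by (intro nat_incseq_bounded_eventually_const monoI guess_mono)
qed

section \<open>Monotonicity and convergence of the stages\<close>

lemma state_0 [simp]: "state e s 0 = pe 0 1"
  by (simp add: state_def)

lemma state_Suc: "state e s (Suc x) = avoid x (ones_zero (guess e x s) (state e s x)) s"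
  by (simp add: state_def)

lemma refines_state_Suc: "refines (state e s x) (state e s (Suc x))"
  unfolding state_Suc by (rule refines_trans[OF refines_ones_zero refines_avoid])

lemma refines_state: "x \<le> y \<Longrightarrow> refines (state e s x) (state e s y)"
proof (induction rule: dec_induct)
  case (step y)
  then show ?case using refines_trans refines_state_Suc by blast
qed simp

lemma state_valid: "pfst (state e s x) < 2 ^ psnd (state e s x)"
  by (rule refines_valid[OF refines_state[of 0]]) simp_all

text \<open>The lowest level that changes moves past its old interval, through a larger guess or
  through \<open>avoid\<close>; all higher levels inherit this by
  \<open>passed_refines\<close>.\<close>

lemma state_mono:
  assumes "s \<le> s'"
  shows "state e s x = state e s' x \<or> passed (state e s x) (state e s' x)"
proof (induction x)
  case (Suc x)
  then consider "passed (state e s x) (state e s' x)" | "state e s x = state e s' x" by blast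
  then show ?case
  proof cases
    case 1
    then show ?thesis using passed_refines refines_state_Suc by blast
  next
    case 2
    consider "guess e x s < guess e x s'" | "guess e x s = guess e x s'"
      using guess_mono[OF assms, of e x] by linarith
    then show ?thesis
    proof cases
      case 1
      from passed_refines[OF passed_ones_zero[OF this] refines_avoid refines_avoid]
      show ?thesis unfolding state_Suc 2 by blast
    next
      case eq: 2
      show ?thesis unfolding state_Suc 2 eq by (rule avoid_mono[OF assms])
    qed
  qed
qed simp

lemma left_state_mono:
  assumes "s \<le> s'" "x \<le> x'"
  shows "left (state e s x) \<le> left (state e s' x')"
proof -
  have "left (state e s x) \<le> left (state e s' x)"
    using state_mono[OF assms(1), of e x] width_pos[of "state e s x"] by (auto simp: passed_def)
  also have "\<dots> \<le> left (state e s' x')" by (rule refines_interval(1)[OF refines_state[OF assms(2)]])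
  finally show ?thesis .
qed

lemma left_state_le_half: "left (state e s x) \<le> 1 / 2"
  using refines_left_le[OF refines_state[of 0 x e s]] by (simp add: left_def width_def)

lemma limit_real_LIMSEQ: "(\<lambda>s. left (state e s s)) \<longlonglongrightarrow> limit_real e"
proof -
  have inc: "incseq (\<lambda>s. left (state e s s))" by (intro monoI left_state_mono)
  obtain L where "(\<lambda>s. left (state e s s)) \<longlonglongrightarrow> L"
    by (rule incseq_convergent[OF inc, of "1 / 2"]) (use left_state_le_half in blast)+
  then show ?thesis unfolding limit_real_def by (simp add: limI)
qed

lemma approx_floor: "int (approx e s) = \<lfloor>2 ^ s * left (state e s s)\<rfloor>"
proof -
  have "\<lfloor>real (2 ^ s * pfst (state e s s)) / real (2 ^ psnd (state e s s))\<rfloor> = int (approx e s)"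
    unfolding approx_def by (rule floor_divide_of_nat_eq)
  then show ?thesis by (simp add: left_def)
qed

lemma approx_LIMSEQ: "(\<lambda>s. approx e s / 2 ^ s) \<longlonglongrightarrow> limit_real e"
proof (rule tendsto_sandwich)
  have fl: "real (approx e s) = of_int \<lfloor>2 ^ s * left (state e s s)\<rfloor>" for s
    using approx_floor[of e s] by (metis of_int_of_nat_eq)
  have "approx e s / 2 ^ s \<le> left (state e s s)" for s
  proof -
    have "real (approx e s) \<le> 2 ^ s * left (state e s s)" unfolding fl by (rule of_int_floor_le)
    then show ?thesis by (simp add: field_simps)
  qed
  then show "eventually (\<lambda>s. approx e s / 2 ^ s \<le> left (state e s s)) sequentially" by simp
  have "left (state e s s) - (1 / 2) ^ s \<le> approx e s / 2 ^ s" for s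
  proof -
    have "2 ^ s * left (state e s s) - 1 \<le> real (approx e s)" unfolding fl by linarith
    then have "(2 ^ s * left (state e s s) - 1) / 2 ^ s \<le> approx e s / 2 ^ s"
      by (intro divide_right_mono) auto
    then show ?thesis by (simp add: diff_divide_distrib power_one_over)
  qed
  then show "eventually (\<lambda>s. left (state e s s) - (1 / 2) ^ s \<le> approx e s / 2 ^ s) sequentially" by simp
  have "(\<lambda>s. left (state e s s) - (1 / 2) ^ s) \<longlonglongrightarrow> limit_real e - 0"
    by (intro tendsto_diff limit_real_LIMSEQ LIMSEQ_realpow_zero) auto
  then show "(\<lambda>s. left (state e s s) - (1 / 2) ^ s) \<longlonglongrightarrow> limit_real e" by simp
qed (rule limit_real_LIMSEQ)

lemma left_re_numbering_limit_real: "left_re_numbering limit_real"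
proof (rule left_re_numbering_dyadic_approx[OF recursive_approx])
  show "approx e 0 = 0" for e by (simp add: approx_def)
  show "2 * approx e s \<le> approx e (Suc s)" for e s
  proof -
    have "real (approx e s) \<le> 2 ^ s * left (state e s s)"
      using approx_floor[of e s] by (metis of_int_of_nat_eq of_int_floor_le)
    also have "\<dots> \<le> 2 ^ s * left (state e (Suc s) (Suc s))" by (intro mult_left_mono left_state_mono) auto
    finally have "of_int (int (2 * approx e s)) \<le> 2 ^ Suc s * left (state e (Suc s) (Suc s))" by simp
    \<comment> \<open>An integer below the scaled left end at the next stage is also below its
      floor.\<close>
    then have "int (2 * approx e s) \<le> int (approx e (Suc s))" unfolding approx_floor le_floor_iff .
    then show ?thesis by linarith
  qed
  show "approx e s \<le> 2 ^ (s - 1)" for e s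
  proof (cases s)
    case 0
    then show ?thesis by (simp add: approx_def)
  next
    case (Suc t)
    have "2 ^ s * left (state e s s) \<le> 2 ^ s * (1 / 2)" by (intro mult_left_mono left_state_le_half) simp
    also have "\<dots> = 2 ^ t" using Suc by simp
    finally have "\<lfloor>2 ^ s * left (state e s s)\<rfloor> \<le> \<lfloor>2 ^ t :: real\<rfloor>" by (rule floor_mono)
    then have "int (approx e s) \<le> 2 ^ t" unfolding approx_floor[symmetric]
      by (metis floor_of_int of_int_numeral of_int_power)
    then have "int (approx e s) \<le> int (2 ^ t)" by simp
    then have "approx e s \<le> 2 ^ t" by (simp only: of_nat_le_iff)
    then show ?thesis using Suc by simp
  qed
qed (rule approx_LIMSEQ)

section \<open>The limit of the construction\<close>

text \<open>Each \<open>avoid\<close> settles by itself, so only the guesses strictly below level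
  \<open>k\<close> can prevent stability.\<close>

lemma eventually_state_const:
  assumes "\<And>x. x < k \<Longrightarrow> \<exists>n. eventually (\<lambda>s. guess e x s = n) sequentially"
  shows "\<exists>p. eventually (\<lambda>s. state e s k = p) sequentially"
  using assms
proof (induction k)
  case 0
  show ?case by simp
next
  case (Suc k)
  then obtain p n where "eventually (\<lambda>s. state e s k = p) sequentially"
    "eventually (\<lambda>s. guess e k s = n) sequentially"
    by (metis less_Suc_eq)
  with eventually_avoid[of k "ones_zero n p"]
  have "eventually (\<lambda>s. state e s (Suc k) = avoid_limit k (ones_zero n p)) sequentially"
    by eventually_elim (simp add: state_Suc)
  then show ?case by blast
qed

lemma limit_real_in_interval:
  assumes "eventually (\<lambda>s. state e s x = p) sequentially"
  shows "left p \<le> limit_real e" "limit_real e \<le> left p + width p"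
proof -
  have ev: "eventually (\<lambda>s. refines p (state e s s)) sequentially"
    using assms eventually_ge_at_top[of x]
    by eventually_elim (use refines_state in blast)
  show "left p \<le> limit_real e"
    by (rule tendsto_lowerbound[OF limit_real_LIMSEQ])
      (use ev in \<open>auto elim!: eventually_mono dest: refines_interval(1)\<close>)
  show "limit_real e \<le> left p + width p"
    by (rule tendsto_upperbound[OF limit_real_LIMSEQ])
      (use ev in \<open>auto elim!: eventually_mono dest: refines_left_le\<close>)
qed

text \<open>At the least unstable level, ever longer blocks of ones push the limit to the right end
  of the stable interval, which is dyadic.\<close>

lemma limit_real_dyadic:
  assumes "\<not> (\<exists>n. eventually (\<lambda>s. guess e x s = n) sequentially)"
  shows "\<exists>k l. limit_real e = real k / 2 ^ l"
proof -
  define x0 where "x0 = (LEAST x. \<not> (\<exists>n. eventually (\<lambda>s. guess e x s = n) sequentially))"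
  have x0: "\<not> (\<exists>n. eventually (\<lambda>s. guess e x0 s = n) sequentially)"
    unfolding x0_def using assms by (rule LeastI)
  have "\<exists>n. eventually (\<lambda>s. guess e x s = n) sequentially" if "x < x0" for x
    using not_less_Least[OF that[unfolded x0_def]] by blast
  from eventually_state_const[OF this]
  obtain p where p: "eventually (\<lambda>s. state e s x0 = p) sequentially" by blast
  have "left p + width p * (1 - (1 / 2) ^ N) \<le> limit_real e" for N
  proof -
    \<comment> \<open>If the guesses never reached \<open>N\<close>, they would be bounded and hence
      eventually constant.\<close>
    obtain s0 where s0: "N \<le> guess e x0 s0"
      using nat_incseq_bounded_eventually_const[of "guess e x0" N] x0 guess_mono
      by (meson monoI nat_le_linear)
    have "eventually (\<lambda>s. left p + width p * (1 - (1 / 2) ^ N) \<le> left (state e s s)) sequentially"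
      using p eventually_ge_at_top[of s0] eventually_ge_at_top[of "Suc x0"]
    proof eventually_elim
      case (elim s)
      have "N \<le> guess e x0 s" using s0 guess_mono[OF elim(2), of e x0] by simp
      then have "(1 / 2 :: real) ^ guess e x0 s \<le> (1 / 2) ^ N" by (intro power_decreasing) auto
      then have "left p + width p * (1 - (1 / 2) ^ N) \<le> left (ones_zero (guess e x0 s) p)"
        unfolding left_ones_zero using width_pos[of p] by (intro add_left_mono mult_left_mono) auto
      also have "\<dots> \<le> left (state e s (Suc x0))"
        unfolding state_Suc elim(1) by (rule refines_interval(1)[OF refines_avoid])
      also have "\<dots> \<le> left (state e s s)" by (rule left_state_mono) (use elim(3) in auto)
      finally show ?case .
    qed
    then show ?thesis by (rule tendsto_lowerbound[OF limit_real_LIMSEQ]) simp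
  qed
  moreover have "(\<lambda>N. left p + width p * (1 - (1 / 2) ^ N)) \<longlonglongrightarrow> left p + width p * (1 - 0)"
    by (intro tendsto_intros LIMSEQ_realpow_zero) auto
  ultimately have "left p + width p * (1 - 0) \<le> limit_real e" by (intro LIMSEQ_le_const2) auto
  with limit_real_in_interval(2)[OF p] have "limit_real e = left p + width p" by simp
  also have "\<dots> = real (Suc (pfst p)) / 2 ^ psnd p" by (simp add: left_def width_def field_simps)
  finally show ?thesis by blast
qed

lemma limit_real_Kurtz_random:
  assumes const: "\<And>x. \<exists>n. eventually (\<lambda>s. guess e x s = n) sequentially"
  shows "Kurtz_random_real (limit_real e)"
proof -
  have "\<exists>p. eventually (\<lambda>s. state e s x = p) sequentially" for x
    using const by (rule eventually_state_const)
  then obtain p where p: "\<And>x. eventually (\<lambda>s. state e s x = p x) sequentially" by metis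
  from const obtain n where n: "\<And>x. eventually (\<lambda>s. guess e x s = n x) sequentially" by metis
  have p_Suc: "p (Suc x) = avoid_limit x (ones_zero (n x) (p x))" for x
  proof -
    \<comment> \<open>The equation does not mention \<open>s\<close>, so holding eventually means
      holding.\<close>
    have "eventually (\<lambda>s. p (Suc x) = avoid_limit x (ones_zero (n x) (p x))) sequentially"
      using p[of x] p[of "Suc x"] n[of x] eventually_avoid[of x "ones_zero (n x) (p x)"]
      by eventually_elim (simp add: state_Suc)
    then show ?thesis by simp
  qed
  have ref: "refines (p x) (p (Suc x))" and lt: "psnd (p x) < psnd (p (Suc x))"
    and valid: "pfst (p x) < 2 ^ psnd (p x)" for x
  proof -
    obtain s where s: "state e s x = p x" "state e s (Suc x) = p (Suc x)"
      using eventually_happens[OF eventually_conj[OF p[of x] p[of "Suc x"]]] by auto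
    show "refines (p x) (p (Suc x))" using refines_state_Suc[of e s x] s by simp
    show "pfst (p x) < 2 ^ psnd (p x)" using state_valid[of e s x] s by simp
    have "psnd (p x) < psnd (ones_zero (guess e x s) (p x))" by (simp add: ones_zero_def)
    also have "\<dots> < psnd (p (Suc x))" using psnd_avoid s by (metis state_Suc)
    finally show "psnd (p x) < psnd (p (Suc x))" .
  qed
  have p0: "p 0 = pe 0 1" using eventually_happens[OF p[of 0]] by auto
  have l: "x < psnd (p x)" for x
  proof (induction x)
    case (Suc x)
    then show ?case using lt[of x] by simp
  qed (simp add: p0)
  obtain X where X: "\<And>x. prefix_value X (psnd (p x)) = pfst (p x)"
    \<comment> \<open>\<open>X\<close> is the common extension of the stable strings; both its value
      and \<open>limit_real e\<close> are limits of their left ends.\<close>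
    using prefix_value_limit[of "\<lambda>x. psnd (p x)" "\<lambda>x. pfst (p x)"] l lt ref valid
    by (metis less_imp_le refines_def)
  have "(\<lambda>x. left (p x)) \<longlonglongrightarrow> binary_value X"
  proof -
    have "strict_mono (\<lambda>x. psnd (p x))" using lt by (simp add: strict_mono_Suc_iff)
    from LIMSEQ_subseq_LIMSEQ[OF binary_value_LIMSEQ[of X] this]
    show ?thesis by (simp add: o_def X left_def)
  qed
  moreover have "(\<lambda>x. left (p x)) \<longlonglongrightarrow> limit_real e"
  proof (rule tendsto_sandwich)
    have "limit_real e - (1 / 2) ^ x \<le> left (p x)" for x
    proof -
      have "width (p x) \<le> (1 / 2) ^ x"
        unfolding width_def power_one_over[symmetric] using l[of x] by (intro power_decreasing) auto
      then show ?thesis using limit_real_in_interval(2)[OF p[of x]] by linarith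
    qed
    then show "eventually (\<lambda>x. limit_real e - (1 / 2) ^ x \<le> left (p x)) sequentially" by simp
    show "eventually (\<lambda>x. left (p x) \<le> limit_real e) sequentially"
      using limit_real_in_interval(1)[OF p] by simp
    have "(\<lambda>x. limit_real e - (1 / 2) ^ x) \<longlonglongrightarrow> limit_real e - 0"
      by (intro tendsto_intros LIMSEQ_realpow_zero) auto
    then show "(\<lambda>x. limit_real e - (1 / 2) ^ x) \<longlonglongrightarrow> limit_real e" by simp
  qed simp
  ultimately have val: "binary_value X = limit_real e" by (rule LIMSEQ_unique)
  have "Kurtz_random X"
    unfolding Kurtz_random_def
  proof
    assume "\<exists>P. Pi01_class P \<and> P \<in> null_sets cantor_measure \<and> X \<in> P"
    then obtain P f where P: "P = - (\<Union>\<sigma>\<in>{\<sigma>. string_code \<sigma> \<in> dom f}. cylinder \<sigma>)"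
      "P \<in> null_sets cantor_measure" "X \<in> P" and f: "partrec f"
      unfolding Pi01_class_def re_set_def by blast
    obtain c where c: "\<And>n y. f n = Some y \<longleftrightarrow> evals c n y" using partrec_imp_evals[OF f] by blast
    define q where "q = ones_zero (n c) (p c)"
    have "pfst q < 2 ^ psnd q" unfolding q_def by (rule refines_valid[OF refines_ones_zero valid])
    with c P(1,2) have ex: "\<exists>u. witness c q u" by (rule null_class_witness)
    define u where "u = (LEAST u. witness c q u)"
    have u: "witness c q u" unfolding u_def using ex by (rule LeastI_ex)
    \<comment> \<open>Level \<open>c\<close> has acted for program \<open>c\<close>, so a prefix of
      this string is accepted by \<open>f\<close>. As \<open>X\<close> extends the string, it lies
      in the enumerated open set.\<close>
    have pc: "p (Suc c) = append1 u q" using p_Suc[of c] ex by (simp add: avoid_limit_def q_def u_def)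
    define j y where "j = pfst (psnd (psnd (psnd u)))" and "y = psnd (psnd (psnd (psnd u)))"
    have j: "j \<le> psnd (p (Suc c))"
      and ev: "evals c (string_code (bits (pfst (p (Suc c)) div 2 ^ (psnd (p (Suc c)) - j)) j)) y"
      using u unfolding witness_def Let_def pc[symmetric] j_def[symmetric] y_def[symmetric]
      by (auto intro: evalsI)
    have eq: "pfst (p (Suc c)) div 2 ^ (psnd (p (Suc c)) - j) = prefix_value X j"
      using prefix_value_div[OF j, of X] X by simp
    have "string_code (map X [0..<j]) \<in> dom f"
      using ev c unfolding eq bits_prefix_value by auto
    moreover have "X \<in> cylinder (map X [0..<j])" by (simp add: cylinder_iff_map)
    ultimately show False using P(1,3) by blast
  qed
  with val show ?thesis unfolding Kurtz_random_real_def by blast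
qed

lemma Kurtz_random_real_limit_real_iff:
  "Kurtz_random_real (limit_real e) \<longleftrightarrow> (\<forall>x. \<exists>y. \<forall>z. pe e (pe x (pe y z)) \<in> R)"
  unfolding guess_eventually_const_iff[symmetric]
proof
  assume random: "Kurtz_random_real (limit_real e)"
  show "\<forall>x. \<exists>n. eventually (\<lambda>s. guess e x s = n) sequentially"
  proof (rule ccontr)
    assume "\<not> ?thesis"
    then obtain x where "\<not> (\<exists>n. eventually (\<lambda>s. guess e x s = n) sequentially)" by blast
    from limit_real_dyadic[OF this] random show False
      using not_Kurtz_random_real_dyadic by auto
  qed
next
  assume "\<forall>x. \<exists>n. eventually (\<lambda>s. guess e x s = n) sequentially"
  then show "Kurtz_random_real (limit_real e)" by (intro limit_real_Kurtz_random) blast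
qed

end

theorem theorem4p3:
  fixes \<alpha> :: "nat \<Rightarrow> real"
  assumes "left_re_numbering \<alpha>"
    and "universal_numbering \<alpha>"
    and "acceptable_numbering \<alpha>"
  shows "Pi3_hard {e. Kurtz_random_real (\<alpha> e)}"
  unfolding Pi3_hard_def
proof (intro allI impI)
  fix A
  assume "Pi03 A"
  then obtain R where R: "recursive_set R"
    and A: "A = {e. \<forall>x. \<exists>y. \<forall>z. pe e (pe x (pe y z)) \<in> R}"
    unfolding Pi03_def by blast
  interpret Pi03_matrix R by unfold_locales (rule R)
  obtain f where f: "recursive f" "\<And>e. \<alpha> (f e) = limit_real e"
    using assms(3) left_re_numbering_limit_real unfolding acceptable_numbering_def by blast
  have "e \<in> A \<longleftrightarrow> f e \<in> {e. Kurtz_random_real (\<alpha> e)}" for e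
    by (simp add: A f(2) Kurtz_random_real_limit_real_iff)
  with f(1) show "many_one_reducible A {e. Kurtz_random_real (\<alpha> e)}"
    unfolding many_one_reducible_def by blast
qed

end
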